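(* Let $\xi$ be a vector bundle over a differentiable manifold $M$, let $k\geq1$ be an integer, and let $\nabla$ be a $\mathfrak{D}^k_0(M)$-pseudoconnection of $\xi$ with curvature $R$. Then for all $X,Y,Z\in\mathcal{X}$, $s\in\Omega^0(\xi)$ and $f\in C^\infty(M)$: (1) $R$ is $\mathbb{R}$-trilinear. (2) $R(X,Y)s=-R(Y,X)s$. (3) $R(fX,Y)s=f\,R(X,Y)s$. (4) $R(X,Y)(fs)=\partial\nabla(df(X,Y),s)+f\,R(X,Y)s$. (5) If $\xi=TM$ and $\nabla$ is torsion free, then $$R(X,Y)Z+R(Y,Z)X+R(Z,X)Y=\partial\nabla(X,[Y,Z])+\partial\nabla(Y,[Z,X])+\partial\nabla(Z,[X,Y]).$$
   Context: $\mathcal{X}$ is the module of $C^\infty$ vector fields on $M$, $\Omega^0(\xi)$ the $C^\infty(M)$-module of $C^\infty$ sections of $\xi$. $\mathfrak{D}^k(M)$ is the $C^\infty(M)$-module of all maps $d:\mathcal{X}\times\cdots\times\mathcal{X}\to C^\infty(M)$ ($k$ factors), with pointwise sum and multiplication by functions; $\mathfrak{D}^k_0(M)$ is the submodule of those $d$ that are $C^\infty(M)$-linear in the first variable. For $X\in\mathcal{X}$, $d\in\mathfrak{D}^k(M)$, $X(d)\in\mathfrak{D}^k(M)$ is defined by $X(d)(X_1,\dots,X_k)=X(d(X_1,\dots,X_k))$. For a $C^\infty(M)$-module $\mathfrak{D}$, a $\mathfrak{D}$-pseudoconnection of $\xi$ is an $\mathbb{R}$-bilinear map $\nabla:\mathcal{X}\times\Omega^0(\xi)\to\mathfrak{D}$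 for which there is a $C^\infty(M)$-module homomorphism $P:\Omega^0(\xi)\to\mathfrak{D}$ (the principal homomorphism) with $\nabla_{\varphi X}s=\varphi\nabla_Xs$ and $\nabla_X(\varphi s)=X(\varphi)P(s)+\varphi\nabla_Xs$ for all $X\in\mathcal{X}$, $s\in\Omega^0(\xi)$, $\varphi\in C^\infty(M)$. When $\xi=TM$, $\nabla$ is torsion free if $\nabla_XY-\nabla_YX=P([X,Y])$ for all $X,Y\in\mathcal{X}$. The curvature of a $\mathfrak{D}^k(M)$-pseudoconnection $\nabla$ of $\xi$ (in particular of a $\mathfrak{D}^k_0(M)$-pseudoconnection) is the map $R:\mathcal{X}\times\mathcal{X}\times\Omega^0(\xi)\to\mathfrak{D}^k(M)$, $R(X,Y)s=X(\nabla_Ys)-Y(\nabla_Xs)-\nabla_{[X,Y]}s$. For $f\in C^\infty(M)$, $df(X,Y):=df(Y)X-df(X)Y\in\mathcal{X}$. With $P$ the principal homomorphism of $\nabla$, $\partial\nabla:\mathcal{X}\times\Omega^0(\xi)\to\mathfrak{D}^k(M)$ is $\partial\nabla(X,s):=X(P(s))-\nabla_Xs$. *)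

theory Defs
  imports "HOL-Analysis.Analysis" "HOL-Algebra.Module"
begin

section \<open>Smooth functions on open subsets of \<open>\<real>\<^sup>n\<close>\<close>

text \<open>
  \<open>\<real>\<^sup>n\<close> is \<open>Euclidean_space n\<close>, whose points are the functions \<open>nat \<Rightarrow> real\<close> vanishing from
  \<open>n\<close> on; all \<open>n \<ge> 0\<close> are covered.  Coordinates are numbered \<open>0, \<dots>, n - 1\<close>.
\<close>

definition partial :: "nat \<Rightarrow> ((nat \<Rightarrow> real) \<Rightarrow> real) \<Rightarrow> (nat \<Rightarrow> real) \<Rightarrow> real" where
  "partial i f x = deriv (\<lambda>t. f (x(i := t))) (x i)"

text \<open>To be used for \<open>U\<close> open in \<open>Euclidean_space n\<close> only; values of \<open>f\<close> outside \<open>U\<close> are irrelevant.\<close>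

primrec Ck_on :: "nat \<Rightarrow> nat \<Rightarrow> (nat \<Rightarrow> real) set \<Rightarrow> ((nat \<Rightarrow> real) \<Rightarrow> real) \<Rightarrow> bool" where
  "Ck_on n 0 U f \<longleftrightarrow>
     continuous_map (subtopology (Euclidean_space n) U) euclideanreal f"
| "Ck_on n (Suc k) U f \<longleftrightarrow>
     continuous_map (subtopology (Euclidean_space n) U) euclideanreal f \<and>
     (\<forall>i<n. (\<forall>x\<in>U. (\<lambda>t. f (x(i := t))) differentiable (at (x i))) \<and> Ck_on n k U (partial i f))"

definition Cinf_on :: "nat \<Rightarrow> (nat \<Rightarrow> real) set \<Rightarrow> ((nat \<Rightarrow> real) \<Rightarrow> real) \<Rightarrow> bool" where
  "Cinf_on n U f \<longleftrightarrow> (\<forall>k. Ck_on n k U f)"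


section \<open>Differentiable manifolds\<close>

text \<open>A chart \<open>(U, \<phi>)\<close> consists of its domain and its coordinate map; \<open>\<phi>\<close> matters on \<open>U\<close> only.\<close>

type_synonym 'a chart = "'a set \<times> ('a \<Rightarrow> nat \<Rightarrow> real)"

record 'a mfd =
  mdim :: nat
  mtop :: "'a topology"
  atlas :: "'a chart set"

abbreviation pts :: "'a mfd \<Rightarrow> 'a set" where
  "pts M \<equiv> topspace (mtop M)"

definition is_chart :: "nat \<Rightarrow> 'a topology \<Rightarrow> 'a chart \<Rightarrow> bool" where
  "is_chart n T = (\<lambda>(U, \<phi>).
     openin T U \<and> openin (Euclidean_space n) (\<phi> ` U) \<and>
     homeomorphic_map (subtopology T U) (subtopology (Euclidean_space n) (\<phi> ` U)) \<phi>)"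

text \<open>
  The atlas need not be maximal: smoothness of functions, vector fields and sections with
  respect to an atlas and with respect to the maximal atlas containing it are the same.
\<close>

definition smooth_manifold :: "'a mfd \<Rightarrow> bool" where
  "smooth_manifold M \<longleftrightarrow>
     Hausdorff_space (mtop M) \<and> second_countable (mtop M) \<and>
     (\<forall>c\<in>atlas M. is_chart (mdim M) (mtop M) c) \<and>
     (\<Union>(U, \<phi>)\<in>atlas M. U) = pts M \<and>
     (\<forall>(U, \<phi>)\<in>atlas M. \<forall>(V, \<psi>)\<in>atlas M. \<forall>i<mdim M.
        Cinf_on (mdim M) (\<phi> ` (U \<inter> V)) (\<lambda>x. \<psi> (inv_into U \<phi> x) i))"

text \<open>Smoothness on an open subset \<open>W\<close> of \<open>M\<close>.\<close>

definition smooth_fun_on :: "'a mfd \<Rightarrow> 'a set \<Rightarrow> ('a \<Rightarrow> real) \<Rightarrow> bool" where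
  "smooth_fun_on M W f \<longleftrightarrow>
     (\<forall>(U, \<phi>)\<in>atlas M. Cinf_on (mdim M) (\<phi> ` (U \<inter> W)) (\<lambda>x. f (inv_into U \<phi> x)))"

text \<open>
  The ring \<open>C\<^sup>\<infinity>(M)\<close>.  Functions on \<open>M\<close>, and below sections and maps of \<open>k\<close>-tuples of vector fields,
  are extensional (\<open>undefined\<close> off their domain), so that equality in HOL is equality on the domain.
\<close>

definition smooth_ring :: "'a mfd \<Rightarrow> ('a \<Rightarrow> real) ring" where
  "smooth_ring M =
     \<lparr>carrier = {f \<in> extensional (pts M). smooth_fun_on M (pts M) f},
      mult = (\<lambda>f g. \<lambda>p\<in>pts M. f p * g p), one = (\<lambda>p\<in>pts M. 1),
      zero = (\<lambda>p\<in>pts M. 0), add = (\<lambda>f g. \<lambda>p\<in>pts M. f p + g p)\<rparr>"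

definition const_fun :: "'a mfd \<Rightarrow> real \<Rightarrow> 'a \<Rightarrow> real" where
  "const_fun M c = (\<lambda>p\<in>pts M. c)"


section \<open>Smooth vector bundles and their sections\<close>

text \<open>
  A vector bundle over \<open>M\<close> is given by its fibres and a vector bundle atlas.  The total space is
  the disjoint union of the fibres, with the smooth structure defined by the trivializations.
  In a local trivialization \<open>(U, \<Phi>)\<close>, \<open>\<Phi> p\<close> is the map from the fibre over \<open>p \<in> U\<close> to \<open>\<real>\<^sup>r\<close>.
  The fields \<open>mult\<close> and \<open>one\<close> of the fibres (and of all modules below) play no role.
\<close>

record ('a, 'v) vbundle =
  rank :: nat
  fibre :: "'a \<Rightarrow> (real, 'v) module"
  trivs :: "('a set \<times> ('a \<Rightarrow> 'v \<Rightarrow> nat \<Rightarrow> real)) set"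

text \<open>
  \<open>E\<close> is closed under its operations and \<open>L\<close> is a bijection onto \<open>\<real>\<^sup>r\<close> respecting them, so
  \<open>E\<close> is a real vector space of dimension \<open>r\<close> and \<open>L\<close> is a linear isomorphism.
\<close>

definition fibre_iso :: "nat \<Rightarrow> (real, 'v) module \<Rightarrow> ('v \<Rightarrow> nat \<Rightarrow> real) \<Rightarrow> bool" where
  "fibre_iso r E L \<longleftrightarrow>
     bij_betw L (carrier E) (topspace (Euclidean_space r)) \<and>
     \<zero>\<^bsub>E\<^esub> \<in> carrier E \<and> L \<zero>\<^bsub>E\<^esub> = (\<lambda>i. 0) \<and>
     (\<forall>u\<in>carrier E. \<forall>v\<in>carrier E.
        u \<oplus>\<^bsub>E\<^esub> v \<in> carrier E \<and> L (u \<oplus>\<^bsub>E\<^esub> v) = (\<lambda>i. L u i + L v i)) \<and>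
     (\<forall>c. \<forall>u\<in>carrier E.
        c \<odot>\<^bsub>E\<^esub> u \<in> carrier E \<and> L (c \<odot>\<^bsub>E\<^esub> u) = (\<lambda>i. c * L u i))"

text \<open>In the last clause, \<open>g\<close> is the matrix-valued transition function from \<open>\<Phi>\<close> to \<open>\<Psi>\<close>.\<close>

definition vector_bundle :: "'a mfd \<Rightarrow> ('a, 'v) vbundle \<Rightarrow> bool" where
  "vector_bundle M \<xi> \<longleftrightarrow>
     (\<forall>(U, \<Phi>)\<in>trivs \<xi>. openin (mtop M) U \<and> (\<forall>p\<in>U. fibre_iso (rank \<xi>) (fibre \<xi> p) (\<Phi> p))) \<and>
     (\<Union>(U, \<Phi>)\<in>trivs \<xi>. U) = pts M \<and>
     (\<forall>(U, \<Phi>)\<in>trivs \<xi>. \<forall>(V, \<Psi>)\<in>trivs \<xi>.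
        \<exists>g :: nat \<Rightarrow> nat \<Rightarrow> 'a \<Rightarrow> real.
          (\<forall>i<rank \<xi>. \<forall>j<rank \<xi>. smooth_fun_on M (U \<inter> V) (g i j)) \<and>
          (\<forall>p\<in>U \<inter> V. \<forall>v\<in>carrier (fibre \<xi> p). \<forall>i<rank \<xi>.
             \<Psi> p v i = (\<Sum>j<rank \<xi>. g i j p * \<Phi> p v j)))"

text \<open>The \<open>C\<^sup>\<infinity>(M)\<close>-module \<open>\<Omega>\<^sup>0(\<xi>)\<close> of smooth sections.\<close>

definition sections :: "'a mfd \<Rightarrow> ('a, 'v) vbundle \<Rightarrow> ('a \<Rightarrow> real, 'a \<Rightarrow> 'v) module" where
  "sections M \<xi> =
     \<lparr>carrier = {s \<in> (\<Pi>\<^sub>E p\<in>pts M. carrier (fibre \<xi> p)).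
        \<forall>(U, \<Phi>)\<in>trivs \<xi>. \<forall>i<rank \<xi>. smooth_fun_on M U (\<lambda>p. \<Phi> p (s p) i)},
      mult = undefined, one = undefined,
      zero = (\<lambda>p\<in>pts M. \<zero>\<^bsub>fibre \<xi> p\<^esub>),
      add = (\<lambda>s t. \<lambda>p\<in>pts M. s p \<oplus>\<^bsub>fibre \<xi> p\<^esub> t p),
      smult = (\<lambda>f s. \<lambda>p\<in>pts M. f p \<odot>\<^bsub>fibre \<xi> p\<^esub> s p)\<rparr>"


section \<open>The tangent bundle and vector fields\<close>

text \<open>Real functions that are smooth in some neighbourhood of \<open>p\<close>: representatives of germs at \<open>p\<close>.\<close>

definition smooth_near :: "'a mfd \<Rightarrow> 'a \<Rightarrow> ('a \<Rightarrow> real) set" where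
  "smooth_near M p = {f. \<exists>W. openin (mtop M) W \<and> p \<in> W \<and> smooth_fun_on M W f}"

text \<open>Tangent vectors at \<open>p\<close> are the derivations at \<open>p\<close> of the algebra of germs of smooth functions.\<close>

definition tangent_vectors :: "'a mfd \<Rightarrow> 'a \<Rightarrow> (('a \<Rightarrow> real) \<Rightarrow> real) set" where
  "tangent_vectors M p = {v \<in> extensional (smooth_near M p).
     (\<forall>f\<in>smooth_near M p. \<forall>g\<in>smooth_near M p.
        (\<forall>W. openin (mtop M) W \<and> p \<in> W \<and> (\<forall>q\<in>W. f q = g q) \<longrightarrow> v f = v g) \<and>
        v (\<lambda>q. f q + g q) = v f + v g \<and>
        v (\<lambda>q. f q * g q) = f p * v g + g p * v f) \<and>
     (\<forall>c. \<forall>f\<in>smooth_near M p. v (\<lambda>q. c * f q) = c * v f)}"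

definition tangent_space :: "'a mfd \<Rightarrow> 'a \<Rightarrow> (real, ('a \<Rightarrow> real) \<Rightarrow> real) module" where
  "tangent_space M p =
     \<lparr>carrier = tangent_vectors M p, mult = undefined, one = undefined,
      zero = (\<lambda>f\<in>smooth_near M p. 0),
      add = (\<lambda>u v. \<lambda>f\<in>smooth_near M p. u f + v f),
      smult = (\<lambda>c v. \<lambda>f\<in>smooth_near M p. c * v f)\<rparr>"

text \<open>
  The trivialization of \<open>TM\<close> over a chart with coordinates \<open>x\<^sub>0, \<dots>, x\<^sub>n\<^sub>-\<^sub>1\<close> sends \<open>v\<close> to its
  components \<open>v(x\<^sub>i)\<close> with respect to the basis \<open>\<partial>/\<partial>x\<^sub>i\<close>.
\<close>

definition tangent_bundle :: "'a mfd \<Rightarrow> ('a, ('a \<Rightarrow> real) \<Rightarrow> real) vbundle" where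
  "tangent_bundle M =
     \<lparr>rank = mdim M, fibre = tangent_space M,
      trivs = (\<lambda>(U, \<phi>). (U, \<lambda>p v i. v (\<lambda>q. \<phi> q i))) ` atlas M\<rparr>"

type_synonym 'a vfield = "'a \<Rightarrow> ('a \<Rightarrow> real) \<Rightarrow> real"

abbreviation vfields :: "'a mfd \<Rightarrow> ('a \<Rightarrow> real, 'a vfield) module" where
  "vfields M \<equiv> sections M (tangent_bundle M)"

text \<open>\<open>X(f) = df(X)\<close>\<close>

definition vf_app :: "'a mfd \<Rightarrow> 'a vfield \<Rightarrow> ('a \<Rightarrow> real) \<Rightarrow> 'a \<Rightarrow> real" where
  "vf_app M X f = (\<lambda>p\<in>pts M. X p f)"

definition bracket :: "'a mfd \<Rightarrow> 'a vfield \<Rightarrow> 'a vfield \<Rightarrow> 'a vfield" where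
  "bracket M X Y = (\<lambda>p\<in>pts M. \<lambda>f\<in>smooth_near M p. X p (\<lambda>q. Y q f) - Y p (\<lambda>q. X q f))"

text \<open>\<open>df(X, Y) = df(Y)X - df(X)Y\<close>\<close>

definition df2 :: "'a mfd \<Rightarrow> ('a \<Rightarrow> real) \<Rightarrow> 'a vfield \<Rightarrow> 'a vfield \<Rightarrow> 'a vfield" where
  "df2 M f X Y =
     (vf_app M Y f \<odot>\<^bsub>vfields M\<^esub> X) \<ominus>\<^bsub>vfields M\<^esub> (vf_app M X f \<odot>\<^bsub>vfields M\<^esub> Y)"


section \<open>The modules \<open>\<DD>\<^sup>k(M)\<close> and \<open>\<DD>\<^sup>k\<^sub>0(M)\<close>\<close>

definition vf_tuples :: "'a mfd \<Rightarrow> nat \<Rightarrow> 'a vfield list set" where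
  "vf_tuples M k = {Xs. length Xs = k \<and> set Xs \<subseteq> carrier (vfields M)}"

definition DD :: "'a mfd \<Rightarrow> nat \<Rightarrow> ('a \<Rightarrow> real, 'a vfield list \<Rightarrow> 'a \<Rightarrow> real) module" where
  "DD M k =
     \<lparr>carrier = (vf_tuples M k \<rightarrow>\<^sub>E carrier (smooth_ring M)), mult = undefined, one = undefined,
      zero = (\<lambda>Xs\<in>vf_tuples M k. \<zero>\<^bsub>smooth_ring M\<^esub>),
      add = (\<lambda>d e. \<lambda>Xs\<in>vf_tuples M k. d Xs \<oplus>\<^bsub>smooth_ring M\<^esub> e Xs),
      smult = (\<lambda>f d. \<lambda>Xs\<in>vf_tuples M k. f \<otimes>\<^bsub>smooth_ring M\<^esub> d Xs)\<rparr>"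

text \<open>Meaningful for \<open>k \<ge> 1\<close>.\<close>

definition DD0 :: "'a mfd \<Rightarrow> nat \<Rightarrow> ('a \<Rightarrow> real, 'a vfield list \<Rightarrow> 'a \<Rightarrow> real) module" where
  "DD0 M k = (DD M k)\<lparr>carrier := {d \<in> carrier (DD M k).
     \<forall>Zs\<in>vf_tuples M (k - 1).
       (\<forall>X\<in>carrier (vfields M). \<forall>Y\<in>carrier (vfields M).
          d ((X \<oplus>\<^bsub>vfields M\<^esub> Y) # Zs) = d (X # Zs) \<oplus>\<^bsub>smooth_ring M\<^esub> d (Y # Zs)) \<and>
       (\<forall>f\<in>carrier (smooth_ring M). \<forall>X\<in>carrier (vfields M).
          d ((f \<odot>\<^bsub>vfields M\<^esub> X) # Zs) = f \<otimes>\<^bsub>smooth_ring M\<^esub> d (X # Zs))}\<rparr>"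

text \<open>\<open>X(d)\<close>\<close>

definition vf_appD ::
  "'a mfd \<Rightarrow> nat \<Rightarrow> 'a vfield \<Rightarrow> ('a vfield list \<Rightarrow> 'a \<Rightarrow> real) \<Rightarrow> 'a vfield list \<Rightarrow> 'a \<Rightarrow> real" where
  "vf_appD M k X d = (\<lambda>Xs\<in>vf_tuples M k. vf_app M X (d Xs))"


section \<open>Pseudoconnections\<close>

definition module_hom ::
  "('r, 'x) ring_scheme \<Rightarrow> ('r, 'a, 'y) module_scheme \<Rightarrow> ('r, 'b, 'z) module_scheme \<Rightarrow> ('a \<Rightarrow> 'b) set"
  where
  "module_hom R A B = {h \<in> carrier A \<rightarrow> carrier B.
     (\<forall>x\<in>carrier A. \<forall>y\<in>carrier A. h (x \<oplus>\<^bsub>A\<^esub> y) = h x \<oplus>\<^bsub>B\<^esub> h y) \<and>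
     (\<forall>r\<in>carrier R. \<forall>x\<in>carrier A. h (r \<odot>\<^bsub>A\<^esub> x) = r \<odot>\<^bsub>B\<^esub> h x)}"

text \<open>\<open>\<real>\<close>-linear maps between \<open>C\<^sup>\<infinity>(M)\<close>-modules; \<open>\<real>\<close> acts through the constant functions.\<close>

definition real_linear ::
  "'a mfd \<Rightarrow> ('a \<Rightarrow> real, 'b) module \<Rightarrow> ('a \<Rightarrow> real, 'c) module \<Rightarrow> ('b \<Rightarrow> 'c) \<Rightarrow> bool" where
  "real_linear M A B h \<longleftrightarrow>
     h \<in> carrier A \<rightarrow> carrier B \<and>
     (\<forall>x\<in>carrier A. \<forall>y\<in>carrier A. h (x \<oplus>\<^bsub>A\<^esub> y) = h x \<oplus>\<^bsub>B\<^esub> h y) \<and>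
     (\<forall>c. \<forall>x\<in>carrier A. h (const_fun M c \<odot>\<^bsub>A\<^esub> x) = const_fun M c \<odot>\<^bsub>B\<^esub> h x)"

definition real_bilinear ::
  "'a mfd \<Rightarrow> ('a \<Rightarrow> real, 'b) module \<Rightarrow> ('a \<Rightarrow> real, 'c) module \<Rightarrow> ('a \<Rightarrow> real, 'd) module \<Rightarrow>
   ('b \<Rightarrow> 'c \<Rightarrow> 'd) \<Rightarrow> bool" where
  "real_bilinear M A B D h \<longleftrightarrow>
     (\<forall>y\<in>carrier B. real_linear M A D (\<lambda>x. h x y)) \<and>
     (\<forall>x\<in>carrier A. real_linear M B D (\<lambda>y. h x y))"

definition real_trilinear ::
  "'a mfd \<Rightarrow> ('a \<Rightarrow> real, 'b) module \<Rightarrow> ('a \<Rightarrow> real, 'c) module \<Rightarrow> ('a \<Rightarrow> real, 'd) module \<Rightarrow>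
   ('a \<Rightarrow> real, 'e) module \<Rightarrow> ('b \<Rightarrow> 'c \<Rightarrow> 'd \<Rightarrow> 'e) \<Rightarrow> bool" where
  "real_trilinear M A B C D h \<longleftrightarrow>
     (\<forall>y\<in>carrier B. \<forall>z\<in>carrier C. real_linear M A D (\<lambda>x. h x y z)) \<and>
     (\<forall>x\<in>carrier A. \<forall>z\<in>carrier C. real_linear M B D (\<lambda>y. h x y z)) \<and>
     (\<forall>x\<in>carrier A. \<forall>y\<in>carrier B. real_linear M C D (\<lambda>z. h x y z))"

text \<open>\<open>nabla\<close> is a \<open>D\<close>-pseudoconnection of \<open>\<xi>\<close> with principal homomorphism \<open>P\<close>.\<close>

definition pseudoconnection ::
  "'a mfd \<Rightarrow> ('a, 'v) vbundle \<Rightarrow> ('a \<Rightarrow> real, 'd) module \<Rightarrow>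
   ('a vfield \<Rightarrow> ('a \<Rightarrow> 'v) \<Rightarrow> 'd) \<Rightarrow> (('a \<Rightarrow> 'v) \<Rightarrow> 'd) \<Rightarrow> bool" where
  "pseudoconnection M \<xi> D nabla P \<longleftrightarrow>
     Module.module (smooth_ring M) D \<and>
     real_bilinear M (vfields M) (sections M \<xi>) D nabla \<and>
     P \<in> module_hom (smooth_ring M) (sections M \<xi>) D \<and>
     (\<forall>X\<in>carrier (vfields M). \<forall>s\<in>carrier (sections M \<xi>). \<forall>\<phi>\<in>carrier (smooth_ring M).
        nabla (\<phi> \<odot>\<^bsub>vfields M\<^esub> X) s = \<phi> \<odot>\<^bsub>D\<^esub> nabla X s \<and>
        nabla X (\<phi> \<odot>\<^bsub>sections M \<xi>\<^esub> s) = (vf_app M X \<phi> \<odot>\<^bsub>D\<^esub> P s) \<oplus>\<^bsub>D\<^esub> (\<phi> \<odot>\<^bsub>D\<^esub> nabla X s))"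

text \<open>For \<open>nabla\<close> a pseudoconnection of \<open>TM\<close>.\<close>

definition torsion_free ::
  "'a mfd \<Rightarrow> ('a \<Rightarrow> real, 'd) module \<Rightarrow> ('a vfield \<Rightarrow> 'a vfield \<Rightarrow> 'd) \<Rightarrow> ('a vfield \<Rightarrow> 'd) \<Rightarrow> bool"
  where
  "torsion_free M D nabla P \<longleftrightarrow>
     (\<forall>X\<in>carrier (vfields M). \<forall>Y\<in>carrier (vfields M).
        nabla X Y \<ominus>\<^bsub>D\<^esub> nabla Y X = P (bracket M X Y))"

definition curvature ::
  "'a mfd \<Rightarrow> nat \<Rightarrow> ('a vfield \<Rightarrow> ('a \<Rightarrow> 'v) \<Rightarrow> 'a vfield list \<Rightarrow> 'a \<Rightarrow> real) \<Rightarrow>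
   'a vfield \<Rightarrow> 'a vfield \<Rightarrow> ('a \<Rightarrow> 'v) \<Rightarrow> 'a vfield list \<Rightarrow> 'a \<Rightarrow> real" where
  "curvature M k nabla X Y s =
     vf_appD M k X (nabla Y s) \<ominus>\<^bsub>DD M k\<^esub> vf_appD M k Y (nabla X s) \<ominus>\<^bsub>DD M k\<^esub> nabla (bracket M X Y) s"

text \<open>\<open>\<partial>\<nabla>(X, s)\<close>\<close>

definition del_nabla ::
  "'a mfd \<Rightarrow> nat \<Rightarrow> ('a vfield \<Rightarrow> ('a \<Rightarrow> 'v) \<Rightarrow> 'a vfield list \<Rightarrow> 'a \<Rightarrow> real) \<Rightarrow>
   (('a \<Rightarrow> 'v) \<Rightarrow> 'a vfield list \<Rightarrow> 'a \<Rightarrow> real) \<Rightarrow>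
   'a vfield \<Rightarrow> ('a \<Rightarrow> 'v) \<Rightarrow> 'a vfield list \<Rightarrow> 'a \<Rightarrow> real" where
  "del_nabla M k nabla P X s = vf_appD M k X (P s) \<ominus>\<^bsub>DD M k\<^esub> nabla X s"

end

theory Submission
  imports Defs
begin

text \<open>
  All identities are checked pointwise: a \<open>\<DD>\<^sup>k(M)\<close>-valued expression is evaluated at a tuple of
  vector fields and a point, where the defining rules of a pseudoconnection and the Leibniz rule for
  \<open>X\<close> reduce the claims to ring identities in \<open>\<real>\<close>.  In (5), torsion freeness also turns
  \<open>\<nabla>\<^sub>X[Y,Z] - \<nabla>\<^bsub>[Y,Z]\<^esub>X\<close> into \<open>P([X,[Y,Z]])\<close>, and the cyclic sum of these terms vanishes by the Jacobi
  identity.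

  The analytic content is that \<open>X(f)\<close> and \<open>[X,Y]\<close> are again smooth.  Tangent vectors being derivations
  of germs, this needs \<open>v(f) = \<Sum>\<^sub>i v(x\<^sub>i) \<partial>\<^sub>if\<close>, hence Hadamard's lemma
  \<open>f(y) = f(a) + \<Sum>\<^sub>i (y\<^sub>i - a\<^sub>i) \<integral>\<^sub>0\<^sup>1 \<partial>\<^sub>if(a + t(y - a)) dt\<close> with smooth coefficients, and the chain rule to see
  that the coefficients are smooth in every chart.
\<close>

section \<open>Calculus on open subsets of \<open>\<real>\<^sup>n\<close>\<close>

text \<open>Smoothness means existence and continuity of iterated partial derivatives on coordinate
  subspaces of \<open>nat \<Rightarrow> real\<close>, a space that is not normable, so there is no
  total derivative to work with. The chain rule therefore rests on the one-variable mean value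
  theorem, used one coordinate at a time, and the smoothness of Hadamard's coefficients on
  differentiation under the integral sign. Tangent vectors act on germs, so no bump functions occur.
  In exchange, an iterated expression such as \<open>X p (\<lambda>q. Y q f)\<close> has a meaning
  only after \<open>\<lambda>q. Y q f\<close> is known to be smooth near \<open>p\<close>, and it
  can be expanded only by formulas that hold on a whole neighbourhood of \<open>p\<close>. For
  \<open>d\<close> linear in its first variable, \<open>X(d)\<close> is in general no longer so:
  replacing that variable by a multiple with factor \<open>f\<close> produces the additional term
  \<open>X(f) d\<close>. Hence the curvature lives in \<open>DD M k\<close>, although
  \<open>nabla\<close> and \<open>P\<close> take values in \<open>DD0 M k\<close>, and all
  identities are compared in \<open>DD M k\<close>.\<close>

lemma continuous_map_Euclidean_space_iff:
  assumes "U \<subseteq> topspace (Euclidean_space n)"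
  shows "continuous_map (subtopology (Euclidean_space n) U) euclideanreal f \<longleftrightarrow> continuous_on U f"
proof -
  have "subtopology (Euclidean_space n) U = top_of_set U"
    using assms
    by (simp add: Euclidean_space_def subtopology_subtopology euclidean_product_topology Int_absorb1)
  then show ?thesis by simp
qed

text \<open>Boxes inside the coordinate subspace suit both later uses: the coordinates may be varied
  independently within their intervals, as the hybrid points of the chain rule require, and a box
  around a point \<open>a\<close> of the space is star-shaped about \<open>a\<close>, as Hadamard's
  lemma requires.\<close>

definition cube :: "nat \<Rightarrow> (nat \<Rightarrow> real) \<Rightarrow> real \<Rightarrow> (nat \<Rightarrow> real) set" where
  "cube n a e = {x \<in> topspace (Euclidean_space n). \<forall>i<n. \<bar>x i - a i\<bar> < e}"

lemma cubeD: "x \<in> cube n a e \<Longrightarrow> i < n \<Longrightarrow> \<bar>x i - a i\<bar> < e"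
  and cube_subset: "cube n a e \<subseteq> topspace (Euclidean_space n)"
  and centre_in_cube: "a \<in> topspace (Euclidean_space n) \<Longrightarrow> 0 < e \<Longrightarrow> a \<in> cube n a e"
  by (auto simp: cube_def)

lemma openin_cube: "openin (Euclidean_space n) (cube n a e)"
proof -
  have "open {f :: nat \<Rightarrow> real. \<forall>i\<in>{..<n}. f (id i) \<in> ball (a i) e}"
    by (rule product_topology_basis') auto
  moreover have "cube n a e = {f :: nat \<Rightarrow> real. \<forall>i\<in>{..<n}. f (id i) \<in> ball (a i) e} \<inter> {x. \<forall>i\<ge>n. x i = 0}"
    by (auto simp: cube_def topspace_Euclidean_space dist_real_def abs_minus_commute)
  ultimately show ?thesis
    unfolding Euclidean_space_def openin_subtopology euclidean_product_topology by auto
qed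

text \<open>A basic open set of the product topology gives a radius in every coordinate. From
  \<open>n\<close> on all points of the space have coordinate 0, so only the first \<open>n\<close>
  radii count and they have a positive minimum.\<close>

lemma openin_contains_cube:
  assumes "openin (Euclidean_space n) U" "a \<in> U"
  obtains e where "e > 0" "cube n a e \<subseteq> U"
proof -
  obtain T where T: "openin (powertop_real UNIV) T" "U = T \<inter> {x. \<forall>i\<ge>n. x i = 0}"
    using assms(1) unfolding Euclidean_space_def openin_subtopology by auto
  obtain X where X: "a \<in> (\<Pi>\<^sub>E i\<in>UNIV. X i)" "\<And>i. open (X i)" "(\<Pi>\<^sub>E i\<in>UNIV. X i) \<subseteq> T"
    using product_topology_open_contains_basis[OF T(1), of a] assms(2) T(2)
    by (auto simp: open_openin[symmetric])
  have "\<exists>e>0. ball (a i) e \<subseteq> X i" for i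
    using X(1,2) by (meson PiE_mem UNIV_I open_contains_ball)
  then obtain d where d: "\<And>i. d i > 0" "\<And>i. ball (a i) (d i) \<subseteq> X i" by metis
  \<comment> \<open>The element 1 keeps the minimum meaningful for \<open>n = 0\<close>.\<close>
  define e where "e = Min (insert 1 (d ` {..<n}))"
  have e: "e > 0" "\<And>i. i < n \<Longrightarrow> e \<le> d i"
    using d(1) by (auto simp: e_def)
  have "x \<in> U" if x: "x \<in> cube n a e" for x
  proof -
    have "x i \<in> X i" for i
    proof (cases "i < n")
      case True
      then have "x i \<in> ball (a i) (d i)"
        using cubeD[OF x True] e(2)[OF True] by (simp add: dist_real_def abs_minus_commute)
      then show ?thesis using d(2) by blast
    next
      case False
      then have "x i = a i"
        using x assms(2) T(2) by (auto simp: cube_def topspace_Euclidean_space)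
      then show ?thesis using X(1) by auto
    qed
    then show ?thesis using X(3) x T(2) by (auto simp: cube_def topspace_Euclidean_space)
  qed
  then show ?thesis using that[OF e(1)] by auto
qed

lemma upd_in_Euclidean_space:
  "x \<in> topspace (Euclidean_space n) \<Longrightarrow> i < n \<Longrightarrow> x(i := t) \<in> topspace (Euclidean_space n)"
  by (auto simp: topspace_Euclidean_space)

text \<open>This makes partial derivatives on open sets local: two functions that agree on
  \<open>U\<close> agree along each coordinate line for all parameters near
  \<open>x i\<close>.\<close>

lemma eventually_upd_in:
  assumes U: "openin (Euclidean_space n) U" and x: "x \<in> U" and i: "i < n"
  shows "\<forall>\<^sub>F t in nhds (x i). x(i := t) \<in> U"
proof -
  obtain e where e: "e > 0" "cube n x e \<subseteq> U" using openin_contains_cube[OF U x] .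
  have "x \<in> topspace (Euclidean_space n)" using openin_subset[OF U] x by auto
  then have "x(i := t) \<in> U" if "dist t (x i) < e" for t
    using that e i upd_in_Euclidean_space[of x n i t]
    by (intro subsetD[OF e(2)]) (auto simp: cube_def dist_real_def)
  then show ?thesis unfolding eventually_nhds_metric using e(1) by auto
qed

section \<open>Locality, sums and products of C^k functions\<close>

definition partial_diff_on :: "nat \<Rightarrow> (nat \<Rightarrow> real) set \<Rightarrow> ((nat \<Rightarrow> real) \<Rightarrow> real) \<Rightarrow> bool" where
  "partial_diff_on n U f \<longleftrightarrow> (\<forall>i<n. \<forall>x\<in>U. (\<lambda>t. f (x(i := t))) differentiable (at (x i)))"

lemma partial_DERIV:
  assumes "partial_diff_on n U f" "i < n" "x \<in> U"
  shows "((\<lambda>t. f (x(i := t))) has_real_derivative partial i f x) (at (x i))"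
  using assms unfolding partial_diff_on_def partial_def
  by (metis DERIV_deriv_iff_real_differentiable)

lemma partial_eqI:
  "((\<lambda>t. f (x(i := t))) has_real_derivative D) (at (x i)) \<Longrightarrow> partial i f x = D"
  unfolding partial_def by (rule DERIV_imp_deriv)

lemma Ck_on_0: "U \<subseteq> topspace (Euclidean_space n) \<Longrightarrow> Ck_on n 0 U f \<longleftrightarrow> continuous_on U f"
  by (simp add: continuous_map_Euclidean_space_iff)

lemma Ck_on_Suc: "U \<subseteq> topspace (Euclidean_space n) \<Longrightarrow> Ck_on n (Suc k) U f \<longleftrightarrow>
   continuous_on U f \<and> partial_diff_on n U f \<and> (\<forall>i<n. Ck_on n k U (partial i f))"
  by (auto simp: continuous_map_Euclidean_space_iff partial_diff_on_def)

declare Ck_on.simps [simp del]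

lemma Ck_on_imp_continuous_on:
  "U \<subseteq> topspace (Euclidean_space n) \<Longrightarrow> Ck_on n k U f \<Longrightarrow> continuous_on U f"
  by (cases k) (auto simp: Ck_on_0 Ck_on_Suc)

lemma Ck_on_SucD: "U \<subseteq> topspace (Euclidean_space n) \<Longrightarrow> Ck_on n (Suc k) U f \<Longrightarrow> Ck_on n k U f"
  by (induction k arbitrary: f) (auto simp: Ck_on_0 Ck_on_Suc)

lemma Ck_on_subset:
  assumes "Ck_on n k U f" "V \<subseteq> U" "U \<subseteq> topspace (Euclidean_space n)"
  shows "Ck_on n k V f"
  using assms
proof (induction k arbitrary: f)
  case 0
  then show ?case by (metis Ck_on_0 continuous_on_subset subset_trans)
next
  case (Suc k)
  then have "V \<subseteq> topspace (Euclidean_space n)" by blast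
  with Suc show ?case
    by (auto simp: Ck_on_Suc partial_diff_on_def intro: continuous_on_subset)
qed

lemma partial_diff_on_cong:
  assumes U: "openin (Euclidean_space n) U" and eq: "\<And>x. x \<in> U \<Longrightarrow> f x = g x"
    and f: "partial_diff_on n U f"
  shows "partial_diff_on n U g"
    and "\<And>i x. i < n \<Longrightarrow> x \<in> U \<Longrightarrow> partial i f x = partial i g x"
proof -
  have "((\<lambda>t. g (x(i := t))) has_real_derivative partial i f x) (at (x i))"
    if "i < n" "x \<in> U" for i x
    using partial_DERIV[OF f that] eventually_upd_in[OF U that(2,1)]
    by (subst DERIV_cong_ev[OF refl _ refl, of _ "\<lambda>t. f (x(i := t))"])
      (auto elim!: eventually_mono simp: eq)
  then show "partial_diff_on n U g"
    and "\<And>i x. i < n \<Longrightarrow> x \<in> U \<Longrightarrow> partial i f x = partial i g x"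
    unfolding partial_diff_on_def
    by (auto simp: real_differentiable_def intro!: partial_eqI[symmetric])
qed

text \<open>\<open>Ck_on\<close> recurses on the function \<open>partial i f\<close>, whereas the
  sum, product and chain rules compute this function on \<open>U\<close> only. The congruence lets
  the inductions on \<open>k\<close> put the computed formula in its place.\<close>

lemma Ck_on_cong:
  assumes "openin (Euclidean_space n) U" "\<And>x. x \<in> U \<Longrightarrow> f x = g x" "Ck_on n k U f"
  shows "Ck_on n k U g"
  using assms(2,3)
proof (induction k arbitrary: f g)
  note U = openin_subset[OF assms(1)]
  case 0
  then show ?case by (simp add: Ck_on_0[OF U] cong: continuous_on_cong)
next
  note U = openin_subset[OF assms(1)]
  case (Suc k)
  have "continuous_on U g"
    using Suc.prems by (auto simp: Ck_on_Suc[OF U] cong: continuous_on_cong)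
  moreover have f: "partial_diff_on n U f" using Suc.prems by (simp add: Ck_on_Suc[OF U])
  moreover have "Ck_on n k U (partial i g)" if "i < n" for i
  proof (rule Suc.IH)
    show "partial i f x = partial i g x" if "x \<in> U" for x
      by (rule partial_diff_on_cong(2)[OF assms(1) Suc.prems(1) f \<open>i < n\<close> that])
    show "Ck_on n k U (partial i f)"
      using Suc.prems(2) that by (simp add: Ck_on_Suc[OF U])
  qed
  ultimately show ?case
    using partial_diff_on_cong(1)[OF assms(1) Suc.prems(1) f] by (auto simp: Ck_on_Suc[OF U])
qed

lemma partial_const [simp]: "partial i (\<lambda>x. c) = (\<lambda>x. 0)"
  by (simp add: partial_def fun_eq_iff)

lemma Ck_on_const:
  assumes "U \<subseteq> topspace (Euclidean_space n)"
  shows "Ck_on n k U (\<lambda>x. c)"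
  by (induction k arbitrary: c) (auto simp: Ck_on_0 Ck_on_Suc partial_diff_on_def assms)

lemma partial_add:
  assumes "partial_diff_on n U f" "partial_diff_on n U g"
  shows "partial_diff_on n U (\<lambda>x. f x + g x)"
    and "i < n \<Longrightarrow> x \<in> U \<Longrightarrow> partial i (\<lambda>x. f x + g x) x = partial i f x + partial i g x"
proof -
  have D: "((\<lambda>t. f (x(i := t)) + g (x(i := t))) has_real_derivative
      partial i f x + partial i g x) (at (x i))" if "i < n" "x \<in> U" for i x
    by (intro DERIV_add partial_DERIV[OF assms(1)] partial_DERIV[OF assms(2)] that)
  then show "partial_diff_on n U (\<lambda>x. f x + g x)"
    unfolding partial_diff_on_def real_differentiable_def by blast
  show "partial i (\<lambda>x. f x + g x) x = partial i f x + partial i g x" if "i < n" "x \<in> U"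
    by (rule partial_eqI) (rule D[OF that])
qed

lemma partial_mult:
  assumes "partial_diff_on n U f" "partial_diff_on n U g"
  shows "partial_diff_on n U (\<lambda>x. f x * g x)"
    and "i < n \<Longrightarrow> x \<in> U \<Longrightarrow>
      partial i (\<lambda>x. f x * g x) x = partial i f x * g x + partial i g x * f x"
proof -
  have D: "((\<lambda>t. f (x(i := t)) * g (x(i := t))) has_real_derivative
      partial i f x * g x + partial i g x * f x) (at (x i))" if "i < n" "x \<in> U" for i x
    using DERIV_mult[OF partial_DERIV[OF assms(1) that] partial_DERIV[OF assms(2) that]] by simp
  then show "partial_diff_on n U (\<lambda>x. f x * g x)"
    unfolding partial_diff_on_def real_differentiable_def by blast
  show "partial i (\<lambda>x. f x * g x) x = partial i f x * g x + partial i g x * f x"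
    if "i < n" "x \<in> U"
    by (rule partial_eqI) (rule D[OF that])
qed

lemma Ck_on_add:
  assumes U: "openin (Euclidean_space n) U"
  shows "Ck_on n k U f \<Longrightarrow> Ck_on n k U g \<Longrightarrow> Ck_on n k U (\<lambda>x. f x + g x)"
proof (induction k arbitrary: f g)
  case 0
  then show ?case by (simp add: Ck_on_0[OF openin_subset[OF U]] continuous_on_add)
next
  case (Suc k)
  note Suc_iff = Ck_on_Suc[OF openin_subset[OF U]]
  have fg: "partial_diff_on n U f" "partial_diff_on n U g"
    using Suc.prems by (auto simp: Suc_iff)
  have "Ck_on n k U (partial i (\<lambda>x. f x + g x))" if "i < n" for i
  proof (rule Ck_on_cong[OF U])
    show "Ck_on n k U (\<lambda>x. partial i f x + partial i g x)"
      using Suc.prems that by (intro Suc.IH) (auto simp: Suc_iff)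
  qed (simp add: partial_add[OF fg] that)
  with partial_add(1)[OF fg] Suc.prems show ?case
    by (simp add: Suc_iff continuous_on_add)
qed

lemma Ck_on_mult:
  assumes U: "openin (Euclidean_space n) U"
  shows "Ck_on n k U f \<Longrightarrow> Ck_on n k U g \<Longrightarrow> Ck_on n k U (\<lambda>x. f x * g x)"
proof (induction k arbitrary: f g)
  case 0
  then show ?case by (simp add: Ck_on_0[OF openin_subset[OF U]] continuous_on_mult)
next
  case (Suc k)
  note Suc_iff = Ck_on_Suc[OF openin_subset[OF U]]
  have fg: "partial_diff_on n U f" "partial_diff_on n U g"
    using Suc.prems by (auto simp: Suc_iff)
  have "Ck_on n k U (partial i (\<lambda>x. f x * g x))" if "i < n" for i
  proof (rule Ck_on_cong[OF U])
    show "Ck_on n k U (\<lambda>x. partial i f x * g x + partial i g x * f x)"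
      \<comment> \<open>Each summand of the product rule pairs a derivative, known to be C^k, with
        an undifferentiated factor of class C^(k+1), which is first weakened to C^k.\<close>
      using Suc.prems that Ck_on_SucD[OF openin_subset[OF U]]
      by (intro Ck_on_add[OF U] Suc.IH) (auto simp: Suc_iff)
  qed (simp add: partial_mult[OF fg] that)
  with partial_mult(1)[OF fg] Suc.prems show ?case
    by (simp add: Suc_iff continuous_on_mult)
qed

lemma Ck_on_sum:
  assumes U: "openin (Euclidean_space n) U" and "\<And>i. i \<in> I \<Longrightarrow> Ck_on n k U (f i)"
  shows "Ck_on n k U (\<lambda>x. \<Sum>i\<in>I. f i x)"
  using assms(2)
  by (induction I rule: infinite_finite_induct)
    (auto intro!: Ck_on_const Ck_on_add[OF U] openin_subset[OF U])

text \<open>A coordinate of a curve may move in either direction or not at all, so no order of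
  \<open>a\<close> and \<open>b\<close> is fixed. The intermediate point is located only by its
  distance from \<open>a\<close>; this bound is what makes it converge to \<open>a\<close> when
  \<open>b\<close> does.\<close>

lemma mvt_abs:
  fixes \<phi> :: "real \<Rightarrow> real"
  assumes "\<And>s. \<bar>s - a\<bar> \<le> \<bar>b - a\<bar> \<Longrightarrow> (\<phi> has_real_derivative \<phi>' s) (at s)"
  shows "\<exists>s. \<bar>s - a\<bar> \<le> \<bar>b - a\<bar> \<and> \<phi> b - \<phi> a = \<phi>' s * (b - a)"
proof -
  consider "a = b" | "a < b" | "b < a" by linarith
  then show ?thesis
  proof cases
    case 1
    then show ?thesis by auto
  next
    case 2
    then obtain z where "a < z" "z < b" "\<phi> b - \<phi> a = (b - a) * \<phi>' z"
      using MVT2[OF 2, of \<phi> \<phi>'] assms by auto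
    then show ?thesis by (intro exI[of _ z]) auto
  next
    case 3
    then obtain z where "b < z" "z < a" "\<phi> a - \<phi> b = (a - b) * \<phi>' z"
      using MVT2[OF 3, of \<phi> \<phi>'] assms by auto
    then show ?thesis by (intro exI[of _ z]) (auto simp: algebra_simps)
  qed
qed

lemma tendsto_fun_iff:
  fixes f :: "'b \<Rightarrow> 'i \<Rightarrow> 'a :: topological_space"
  shows "(f \<longlongrightarrow> l) F \<longleftrightarrow> (\<forall>i. ((\<lambda>x. f x i) \<longlongrightarrow> l i) F)"
  using limitin_componentwise[of "\<lambda>i. euclidean" UNIV f l F]
  by (simp add: euclidean_product_topology)

text \<open>The increment of \<open>f\<close> is split along the coordinate directions through the hybrid points
  \<open>h m t\<close>, and the mean value theorem is applied to each piece.\<close>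

lemma chain_rule_curve:
  assumes U: "openin (Euclidean_space n) U" and f: "Ck_on n (Suc 0) U f"
    and t0: "\<gamma> t0 \<in> U" and ev: "\<forall>\<^sub>F t in nhds t0. \<gamma> t \<in> topspace (Euclidean_space n)"
    and d: "\<And>i. i < n \<Longrightarrow> ((\<lambda>t. \<gamma> t i) has_real_derivative \<gamma>' i) (at t0)"
  shows "((\<lambda>t. f (\<gamma> t)) has_real_derivative (\<Sum>i<n. partial i f (\<gamma> t0) * \<gamma>' i)) (at t0)"
proof -
  note Us = openin_subset[OF U]
  have f': "partial_diff_on n U f" "\<And>i. i < n \<Longrightarrow> continuous_on U (partial i f)"
    using f by (auto simp: Ck_on_Suc[OF Us] Ck_on_0[OF Us])
  define h where "h m t = (\<lambda>i. if i < m then \<gamma> t i else \<gamma> t0 i)" for m t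
  have h0: "h m t0 = \<gamma> t0" for m by (auto simp: h_def)
  have t0E: "\<gamma> t0 \<in> topspace (Euclidean_space n)" using t0 Us by blast
  obtain e where e: "e > 0" "cube n (\<gamma> t0) e \<subseteq> U" using openin_contains_cube[OF U t0] .
  have lim: "((\<lambda>t. \<gamma> t i) \<longlongrightarrow> \<gamma> t0 i) (at t0)" if "i < n" for i
    using DERIV_isCont[OF d[OF that]] by (simp add: isCont_def)
  have "\<forall>\<^sub>F t in at t0. \<bar>\<gamma> t i - \<gamma> t0 i\<bar> < e" if "i < n" for i
    using tendstoD[OF lim[OF that] e(1)] by (simp add: dist_real_def)
  then have near: "\<forall>\<^sub>F t in at t0. \<forall>i\<in>{..<n}. \<bar>\<gamma> t i - \<gamma> t0 i\<bar> < e"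
    by (intro eventually_ball_finite) auto
  have "((\<lambda>t. f (h m t)) has_real_derivative (\<Sum>i<m. partial i f (\<gamma> t0) * \<gamma>' i)) (at t0)"
    if "m \<le> n" for m
    using that
  proof (induction m)
    case 0
    then show ?case by (simp add: h_def)
  next
    case (Suc m)
    then have m: "m < n" by simp
    define F where "F t = f (h (Suc m) t) - f (h m t)" for t
    \<comment> \<open>\<open>h (Suc m) t\<close> and \<open>h m t\<close> differ in coordinate
      \<open>m\<close> only, so \<open>F t\<close> is the increment of a function of one variable,
      and \<open>mid t s\<close> says that \<open>s\<close> is a mean value point for it.\<close>
    define mid where "mid t s \<longleftrightarrow> \<bar>s - \<gamma> t0 m\<bar> \<le> \<bar>\<gamma> t m - \<gamma> t0 m\<bar> \<and>
        F t = partial m f ((h m t)(m := s)) * (\<gamma> t m - \<gamma> t0 m)" for t s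
    have in_U: "(h m t)(m := s) \<in> U"
      if "\<forall>i\<in>{..<n}. \<bar>\<gamma> t i - \<gamma> t0 i\<bar> < e" "\<bar>s - \<gamma> t0 m\<bar> \<le> \<bar>\<gamma> t m - \<gamma> t0 m\<bar>" for t s
    proof -
      have "\<bar>s - \<gamma> t0 m\<bar> < e" using that(2) bspec[OF that(1), of m] m by simp
      then have "(h m t)(m := s) \<in> cube n (\<gamma> t0) e"
        using that(1) m e(1) t0E by (auto simp: cube_def h_def topspace_Euclidean_space)
      then show ?thesis using e(2) by blast
    qed
    have "\<exists>s. mid t s" if t: "\<forall>i\<in>{..<n}. \<bar>\<gamma> t i - \<gamma> t0 i\<bar> < e" for t
    proof -
      have "((\<lambda>r. f ((h m t)(m := r))) has_real_derivative partial m f ((h m t)(m := s))) (at s)"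
        if "\<bar>s - \<gamma> t0 m\<bar> \<le> \<bar>\<gamma> t m - \<gamma> t0 m\<bar>" for s
        using partial_DERIV[OF f'(1) m in_U[OF t that]] by simp
      moreover have "h (Suc m) t = (h m t)(m := \<gamma> t m)" "h m t = (h m t)(m := \<gamma> t0 m)"
        by (auto simp: h_def)
      ultimately show ?thesis
        using mvt_abs[of "\<gamma> t0 m" "\<gamma> t m" "\<lambda>r. f ((h m t)(m := r))"] by (auto simp: mid_def F_def)
    qed
    then have mid: "mid t (SOME s. mid t s)" if "\<forall>i\<in>{..<n}. \<bar>\<gamma> t i - \<gamma> t0 i\<bar> < e" for t
      using that by (meson someI_ex)
    \<comment> \<open>A choice of mean value points made without any continuity. The distance bound
      in \<open>mid\<close> alone squeezes \<open>c t\<close> to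
      \<open>\<gamma> t0 m\<close>.\<close>
    define c where "c t = (SOME s. mid t s)" for t
    have ev_c: "\<forall>\<^sub>F t in at t0. mid t (c t)"
      using near by eventually_elim (simp add: mid c_def)
    have "((\<lambda>t. c t - \<gamma> t0 m) \<longlongrightarrow> 0) (at t0)"
    proof (rule Lim_null_comparison)
      show "\<forall>\<^sub>F t in at t0. norm (c t - \<gamma> t0 m) \<le> \<bar>\<gamma> t m - \<gamma> t0 m\<bar>"
        using ev_c by eventually_elim (simp add: mid_def)
      show "((\<lambda>t. \<bar>\<gamma> t m - \<gamma> t0 m\<bar>) \<longlongrightarrow> 0) (at t0)"
        using lim[OF m] by (simp add: LIM_zero tendsto_rabs_zero)
    qed
    then have c: "(c \<longlongrightarrow> \<gamma> t0 m) (at t0)" by (simp add: LIM_zero_cancel)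
    \<comment> \<open>The point at which the partial derivative is evaluated tends to
      \<open>\<gamma> t0\<close> in every coordinate, and continuity of \<open>partial m f\<close>
      then gives the limit of the difference quotient.\<close>
    have "((\<lambda>t. (h m t)(m := c t)) \<longlongrightarrow> \<gamma> t0) (at t0)"
      unfolding tendsto_fun_iff
    proof
      show "((\<lambda>t. ((h m t)(m := c t)) i) \<longlongrightarrow> \<gamma> t0 i) (at t0)" for i
        using c lim[of i] m by (cases "i < m"; cases "i = m") (auto simp: h_def)
    qed
    then have "((\<lambda>t. partial m f ((h m t)(m := c t))) \<longlongrightarrow> partial m f (\<gamma> t0)) (at t0)"
    proof (rule continuous_on_tendsto_compose[OF f'(2)[OF m] _ t0])
      show "\<forall>\<^sub>F t in at t0. (h m t)(m := c t) \<in> U"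
        using ev_c near by eventually_elim (auto simp: mid_def intro: in_U)
    qed
    moreover have "((\<lambda>t. (\<gamma> t m - \<gamma> t0 m) / (t - t0)) \<longlongrightarrow> \<gamma>' m) (at t0)"
      using d[OF m] by (simp add: has_field_derivative_iff)
    ultimately have "((\<lambda>t. partial m f ((h m t)(m := c t)) * ((\<gamma> t m - \<gamma> t0 m) / (t - t0)))
        \<longlongrightarrow> partial m f (\<gamma> t0) * \<gamma>' m) (at t0)"
      by (rule tendsto_mult)
    moreover have "\<forall>\<^sub>F t in at t0. partial m f ((h m t)(m := c t)) * ((\<gamma> t m - \<gamma> t0 m) / (t - t0)) =
        (F t - F t0) / (t - t0)"
      using ev_c by eventually_elim (simp add: mid_def F_def h0)
    ultimately have "((\<lambda>t. (F t - F t0) / (t - t0)) \<longlongrightarrow> partial m f (\<gamma> t0) * \<gamma>' m) (at t0)"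
      by (rule Lim_transform_eventually)
    then have "(F has_real_derivative partial m f (\<gamma> t0) * \<gamma>' m) (at t0)"
      by (simp add: has_field_derivative_iff)
    from DERIV_add[OF Suc.IH this] m show ?case by (simp add: F_def)
  qed
  from this[of n] have
    "((\<lambda>t. f (h n t)) has_real_derivative (\<Sum>i<n. partial i f (\<gamma> t0) * \<gamma>' i)) (at t0)"
    by simp
  \<comment> \<open>From coordinate \<open>n\<close> on, \<open>h n t\<close> carries the
    coordinates of \<open>\<gamma> t0\<close>. Those of \<open>\<gamma> t\<close> are the same
    because both points lie in the space, where they are 0; this is the role of
    \<open>ev\<close>.\<close>
  moreover have "\<forall>\<^sub>F t in nhds t0. f (h n t) = f (\<gamma> t)"
    using ev
  proof eventually_elim
    case (elim t)
    then have "h n t = \<gamma> t" using t0E by (auto simp: h_def topspace_Euclidean_space)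
    then show ?case by simp
  qed
  ultimately show ?thesis by (subst (asm) DERIV_cong_ev[OF refl _ refl])
qed

text \<open>By the chain rule the partial derivatives of the composite are sums of products of
  \<open>partial i f\<close> after \<open>G\<close> with derivatives of the coordinates of
  \<open>G\<close>. The induction hypothesis applies to \<open>partial i f\<close> with the same
  \<open>G\<close>, taken as C^k only.\<close>

lemma Ck_on_compose:
  assumes U: "openin (Euclidean_space m) U" and V: "openin (Euclidean_space n) V"
    and GV: "\<And>x. x \<in> U \<Longrightarrow> G x \<in> V"
  shows "Ck_on n k V f \<Longrightarrow> (\<And>i. i < n \<Longrightarrow> Ck_on m k U (\<lambda>x. G x i)) \<Longrightarrow> Ck_on m k U (\<lambda>x. f (G x))"
proof (induction k arbitrary: f)
  note Us = openin_subset[OF U] and Vs = openin_subset[OF V]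
  have cont: "continuous_on U (\<lambda>x. f (G x))"
    if "continuous_on V f" "\<And>i. i < n \<Longrightarrow> continuous_on U (\<lambda>x. G x i)" for f :: "(nat \<Rightarrow> real) \<Rightarrow> real"
  proof (rule continuous_on_compose2[OF that(1)])
    \<comment> \<open>The hypotheses speak of the first \<open>n\<close> coordinates of
      \<open>G\<close>; the others vanish on \<open>U\<close> because \<open>G\<close> maps into
      \<open>V\<close>.\<close>
    have "continuous_on U (\<lambda>x. G x i)" if "\<not> i < n" for i
    proof -
      have "\<forall>x\<in>U. G x i = 0" using that GV Vs by (force simp: topspace_Euclidean_space)
      then show ?thesis by (simp cong: continuous_on_cong)
    qed
    with that(2) show "continuous_on U G"
      by (intro continuous_on_coordinatewise_then_product) blast
  qed (use GV in auto)
  {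
    case 0
    then show ?case using cont by (simp add: Ck_on_0[OF Us] Ck_on_0[OF Vs])
  next
    case (Suc k)
    have G: "partial_diff_on m U (\<lambda>x. G x i)" if "i < n" for i
      using Suc.prems(2)[OF that] by (simp add: Ck_on_Suc[OF Us])
    have f1: "Ck_on n (Suc 0) V f"
      using Suc.prems(1) Ck_on_imp_continuous_on[OF Vs]
      by (auto simp: Ck_on_Suc[OF Vs] Ck_on_0[OF Vs])
    have D: "((\<lambda>t. f (G (x(j := t)))) has_real_derivative
        (\<Sum>i<n. partial i f (G x) * partial j (\<lambda>x. G x i) x)) (at (x j))" if "j < m" "x \<in> U" for j x
    proof -
      have "\<forall>\<^sub>F t in nhds (x j). G (x(j := t)) \<in> topspace (Euclidean_space n)"
        using eventually_upd_in[OF U that(2,1)] GV Vs by (auto elim!: eventually_mono)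
      then show ?thesis
        using chain_rule_curve[OF V f1, of "\<lambda>t. G (x(j := t))" "x j" "\<lambda>i. partial j (\<lambda>x. G x i) x"]
          GV[OF that(2)] partial_DERIV[OF G that] by simp
    qed
    have "Ck_on m k U (partial j (\<lambda>x. f (G x)))" if "j < m" for j
    proof (rule Ck_on_cong[OF U])
      show "(\<Sum>i<n. partial i f (G x) * partial j (\<lambda>x. G x i) x) = partial j (\<lambda>x. f (G x)) x"
        if "x \<in> U" for x
        by (rule partial_eqI[symmetric]) (rule D[OF \<open>j < m\<close> that])
      show "Ck_on m k U (\<lambda>x. \<Sum>i<n. partial i f (G x) * partial j (\<lambda>x. G x i) x)"
      proof (rule Ck_on_sum[OF U], rule Ck_on_mult[OF U])
        fix i assume i: "i \<in> {..<n}"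
        have "Ck_on n k V (partial i f)" using Suc.prems(1) i by (simp add: Ck_on_Suc[OF Vs])
        moreover have "Ck_on m k U (\<lambda>x. G x l)" if "l < n" for l
          by (rule Ck_on_SucD[OF Us Suc.prems(2)[OF that]])
        ultimately show "Ck_on m k U (\<lambda>x. partial i f (G x))" by (rule Suc.IH)
        show "Ck_on m k U (partial j (\<lambda>x. G x i))"
          using Suc.prems(2)[of i] i that by (simp add: Ck_on_Suc[OF Us])
      qed
    qed
    moreover have "partial_diff_on m U (\<lambda>x. f (G x))"
      unfolding partial_diff_on_def real_differentiable_def using D by blast
    moreover have "continuous_on U (\<lambda>x. f (G x))"
      by (rule cont) (use Suc.prems in \<open>auto simp: Ck_on_Suc[OF Us] Ck_on_Suc[OF Vs]\<close>)
    ultimately show ?case by (simp add: Ck_on_Suc[OF Us])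
  }
qed

section \<open>Hadamard's lemma\<close>

definition segment_point :: "(nat \<Rightarrow> real) \<Rightarrow> (nat \<Rightarrow> real) \<Rightarrow> real \<Rightarrow> nat \<Rightarrow> real" where
  "segment_point a y t = (\<lambda>i. a i + t * (y i - a i))"

text \<open>Hadamard's coefficients are the case \<open>m = 0\<close> with a partial derivative in
  place of \<open>f\<close>. The weights \<open>t ^ m\<close> arise because every differentiation in
  \<open>y\<close> brings out one factor \<open>t\<close>.\<close>

definition radial_integral :: "(nat \<Rightarrow> real) \<Rightarrow> nat \<Rightarrow> ((nat \<Rightarrow> real) \<Rightarrow> real) \<Rightarrow> (nat \<Rightarrow> real) \<Rightarrow> real" where
  "radial_integral a m f y = integral (cbox 0 1) (\<lambda>t. t ^ m * f (segment_point a y t))"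

lemma segment_point_in_cube:
  assumes "a \<in> topspace (Euclidean_space n)" "y \<in> cube n a e" "t \<in> cbox 0 1"
  shows "segment_point a y t \<in> cube n a e"
proof -
  have "\<bar>t * (y i - a i)\<bar> \<le> \<bar>y i - a i\<bar>" for i
    using assms(3) by (simp add: abs_mult mult_left_le_one_le)
  then have "\<bar>t * (y i - a i)\<bar> < e" if "i < n" for i
    using cubeD[OF assms(2) that] le_less_trans by blast
  then show ?thesis
    using assms by (auto simp: cube_def segment_point_def topspace_Euclidean_space)
qed

lemma continuous_on_coord_fst: "continuous_on S (\<lambda>p :: (nat \<Rightarrow> real) \<times> real. fst p i)"
  by (rule continuous_on_product_then_coordinatewise) (rule continuous_on_fst[OF continuous_on_id])

lemma continuous_on_radial_integrand:
  assumes a: "a \<in> topspace (Euclidean_space n)" and f: "continuous_on (cube n a e) f"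
  shows "continuous_on (cube n a e \<times> cbox 0 1) (\<lambda>(y, t). t ^ m * f (segment_point a y t))"
proof -
  have "continuous_on (cube n a e \<times> cbox 0 1) (\<lambda>p. segment_point a (fst p) (snd p))"
    unfolding segment_point_def
    by (intro continuous_on_coordinatewise_then_product continuous_on_add continuous_on_mult
        continuous_on_diff continuous_on_const continuous_on_snd[OF continuous_on_id]
        continuous_on_coord_fst)
  then have "continuous_on (cube n a e \<times> cbox 0 1) (\<lambda>p. f (segment_point a (fst p) (snd p)))"
    by (rule continuous_on_compose2[OF f]) (auto intro: segment_point_in_cube[OF a])
  then have "continuous_on (cube n a e \<times> cbox 0 1)
      (\<lambda>p. snd p ^ m * f (segment_point a (fst p) (snd p)))"
    by (intro continuous_on_mult continuous_on_power continuous_on_snd[OF continuous_on_id])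
  then show ?thesis by (simp add: case_prod_unfold)
qed

lemma integrable_radial_integrand:
  assumes a: "a \<in> topspace (Euclidean_space n)" and f: "continuous_on (cube n a e) f"
    and y: "y \<in> cube n a e"
  shows "(\<lambda>t. t ^ m * f (segment_point a y t)) integrable_on cbox 0 1"
proof (rule integrable_continuous)
  have "continuous_on (cbox 0 1) (\<lambda>t. (y, t))" by (intro continuous_intros)
  from continuous_on_compose2[OF continuous_on_radial_integrand[OF a f, of m] this] y
  show "continuous_on (cbox 0 1) (\<lambda>t. t ^ m * f (segment_point a y t))" by auto
qed

text \<open>Differentiation under the integral sign, on the open interval \<open>?I\<close> of
  values of the \<open>i\<close>-th coordinate that keep the point in the cube. The derivative of
  the integrand is jointly continuous there.\<close>

lemma partial_radial_integral:
  assumes a: "a \<in> topspace (Euclidean_space n)" and f: "Ck_on n (Suc 0) (cube n a e) f"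
    and y: "y \<in> cube n a e" and i: "i < n"
  shows "((\<lambda>r. radial_integral a m f (y(i := r))) has_real_derivative
    radial_integral a (Suc m) (partial i f) y) (at (y i))"
proof -
  let ?I = "{a i - e<..<a i + e}"
  have f': "continuous_on (cube n a e) f" "partial_diff_on n (cube n a e) f"
    "continuous_on (cube n a e) (partial i f)"
    using f i by (auto simp: Ck_on_Suc[OF cube_subset] Ck_on_0[OF cube_subset])
  have upd: "y(i := r) \<in> cube n a e" if "r \<in> ?I" for r
    using that y i by (auto simp: cube_def topspace_Euclidean_space)
  have yi: "y i \<in> ?I" using cubeD[OF y i] by auto
  have "((\<lambda>r. integral (cbox 0 1) (\<lambda>t. t ^ m * f (segment_point a (y(i := r)) t))) has_real_derivative
     integral (cbox 0 1) (\<lambda>t. t ^ Suc m * partial i f (segment_point a (y(i := y i)) t))) (at (y i) within ?I)"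
  proof (rule leibniz_rule_field_derivative[where fx = "\<lambda>r t. t ^ Suc m * partial i f (segment_point a (y(i := r)) t)"])
    fix r t :: real assume r: "r \<in> ?I" and t: "t \<in> cbox 0 1"
    define z where "z = segment_point a (y(i := r)) t"
    \<comment> \<open>Moving the endpoint in coordinate \<open>i\<close> moves the point at time
      \<open>t\<close> in the same coordinate only, at rate \<open>t\<close>. This rate turns the
      weight \<open>t ^ m\<close> into \<open>t ^ Suc m\<close>.\<close>
    have zz: "segment_point a (y(i := s)) t = z(i := a i + t * (s - a i))" for s
      by (auto simp: z_def segment_point_def)
    have zi: "z i = a i + t * (r - a i)" by (simp add: z_def segment_point_def)
    have "((\<lambda>u. f (z(i := u))) has_real_derivative partial i f z) (at (a i + t * (r - a i)))"
      using partial_DERIV[OF f'(2) i segment_point_in_cube[OF a upd[OF r] t]]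
      by (simp add: z_def[symmetric] zi)
    moreover have "((\<lambda>s. a i + t * (s - a i)) has_real_derivative t) (at r)"
      by (auto intro!: derivative_eq_intros)
    ultimately have "((\<lambda>s. f (z(i := a i + t * (s - a i)))) has_real_derivative partial i f z * t) (at r)"
      by (rule DERIV_chain2)
    then have "((\<lambda>s. t ^ m * f (z(i := a i + t * (s - a i)))) has_real_derivative
        t ^ m * (partial i f z * t)) (at r)"
      by (rule DERIV_cmult)
    then show "((\<lambda>s. t ^ m * f (segment_point a (y(i := s)) t)) has_real_derivative
        t ^ Suc m * partial i f (segment_point a (y(i := r)) t)) (at r within ?I)"
      unfolding z_def[symmetric] by (simp add: zz mult_ac has_field_derivative_at_within)
  next
    show "(\<lambda>t. t ^ m * f (segment_point a (y(i := r)) t)) integrable_on cbox 0 1" if "r \<in> ?I" for r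
      by (rule integrable_radial_integrand[OF a f'(1) upd[OF that]])
  next
    have "continuous_on (?I \<times> cbox 0 1) (\<lambda>p. (y(i := fst p)) j)" for j
      by (cases "j = i") (auto intro!: continuous_intros)
    then have "continuous_on (?I \<times> cbox 0 1) (\<lambda>p. (y(i := fst p), snd p))"
      by (intro continuous_on_Pair continuous_on_coordinatewise_then_product
          continuous_on_snd[OF continuous_on_id])
    moreover have "(\<lambda>p. (y(i := fst p), snd p)) ` (?I \<times> cbox 0 1) \<subseteq> cube n a e \<times> cbox 0 1"
      using upd by fastforce
    ultimately have "continuous_on (?I \<times> cbox 0 1) (\<lambda>p. case (y(i := fst p), snd p) of
        (y, t) \<Rightarrow> t ^ Suc m * partial i f (segment_point a y t))"
      by (rule continuous_on_compose2[OF continuous_on_radial_integrand[OF a f'(3), of "Suc m"]])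
    then show "continuous_on (?I \<times> cbox 0 1) (\<lambda>(r, t). t ^ Suc m * partial i f (segment_point a (y(i := r)) t))"
      by (simp add: case_prod_unfold)
  qed (use yi in auto)
  then show ?thesis using at_within_open[OF yi open_greaterThanLessThan]
    by (simp add: radial_integral_def)
qed

text \<open>The family of radial integrals is closed under partial differentiation, at the cost of
  changing both the function and the weight; hence the induction on \<open>k\<close> has to leave
  \<open>f\<close> and \<open>m\<close> free.\<close>

lemma Ck_on_radial_integral:
  assumes a: "a \<in> topspace (Euclidean_space n)"
  shows "Ck_on n k (cube n a e) f \<Longrightarrow> Ck_on n k (cube n a e) (radial_integral a m f)"
proof (induction k arbitrary: f m)
  have cont: "continuous_on (cube n a e) (radial_integral a m f)"
    if "continuous_on (cube n a e) f" for f m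
    unfolding radial_integral_def
    by (rule integral_continuous_on_param) (rule continuous_on_radial_integrand[OF a that])
  {
    case 0
    then show ?case using cont by (simp add: Ck_on_0[OF cube_subset])
  next
    case (Suc k)
    have f1: "Ck_on n (Suc 0) (cube n a e) f"
      using Suc.prems Ck_on_imp_continuous_on[OF cube_subset]
      by (auto simp: Ck_on_Suc[OF cube_subset] Ck_on_0[OF cube_subset])
    note D = partial_radial_integral[OF a f1]
    have "Ck_on n k (cube n a e) (partial i (radial_integral a m f))" if "i < n" for i
    proof (rule Ck_on_cong[OF openin_cube])
      show "Ck_on n k (cube n a e) (radial_integral a (Suc m) (partial i f))"
        using Suc.prems that by (intro Suc.IH) (simp add: Ck_on_Suc[OF cube_subset])
      show "radial_integral a (Suc m) (partial i f) x = partial i (radial_integral a m f) x"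
        if "x \<in> cube n a e" for x
        by (rule partial_eqI[symmetric]) (rule D[OF that \<open>i < n\<close>])
    qed
    moreover have "partial_diff_on n (cube n a e) (radial_integral a m f)"
      unfolding partial_diff_on_def real_differentiable_def using D by blast
    moreover have "continuous_on (cube n a e) (radial_integral a m f)"
      using Suc.prems by (intro cont) (simp add: Ck_on_Suc[OF cube_subset])
    ultimately show ?case by (simp add: Ck_on_Suc[OF cube_subset])
  }
qed

text \<open>The chain rule gives the derivative of \<open>f\<close> along the segment from
  \<open>a\<close> to \<open>y\<close>, and the fundamental theorem of calculus integrates it over
  the unit interval.\<close>

lemma hadamard:
  assumes a: "a \<in> topspace (Euclidean_space n)" and f: "Ck_on n (Suc 0) (cube n a e) f"
    and y: "y \<in> cube n a e"
  shows "f y = f a + (\<Sum>i<n. (y i - a i) * radial_integral a 0 (partial i f) y)"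
proof -
  have f': "continuous_on (cube n a e) (partial i f)" if "i < n" for i
    using f that by (auto simp: Ck_on_Suc[OF cube_subset] Ck_on_0[OF cube_subset])
  let ?s = "segment_point a y"
  have sE: "?s t \<in> topspace (Euclidean_space n)" for t
    using a y by (auto simp: segment_point_def cube_def topspace_Euclidean_space)
  have "((\<lambda>t. f (?s t)) has_real_derivative (\<Sum>i<n. partial i f (?s t) * (y i - a i))) (at t)"
    if "t \<in> {0..1}" for t
  proof (rule chain_rule_curve[OF openin_cube f])
    show "?s t \<in> cube n a e" using segment_point_in_cube[OF a y] that by simp
    show "((\<lambda>t. ?s t i) has_real_derivative y i - a i) (at t)" for i
      unfolding segment_point_def by (auto intro!: derivative_eq_intros)
  qed (simp add: sE)
  then have "((\<lambda>t. \<Sum>i<n. partial i f (?s t) * (y i - a i)) has_integral f (?s 1) - f (?s 0)) {0..1}"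
    by (intro fundamental_theorem_of_calculus)
      (auto simp: has_real_derivative_iff_has_vector_derivative[symmetric] intro: has_field_derivative_at_within)
  moreover have "?s 1 = y" "?s 0 = a" by (auto simp: segment_point_def)
  ultimately have "f y - f a = integral (cbox 0 1) (\<lambda>t. \<Sum>i<n. partial i f (?s t) * (y i - a i))"
    by (simp add: integral_unique)
  also have "\<dots> = (\<Sum>i<n. integral (cbox 0 1) (\<lambda>t. partial i f (?s t) * (y i - a i)))"
    using integrable_radial_integrand[OF a f' y, where m = 0]
    by (intro integral_sum integrable_on_mult_left) auto
  also have "\<dots> = (\<Sum>i<n. (y i - a i) * radial_integral a 0 (partial i f) y)"
    by (simp add: radial_integral_def mult.commute)
  finally show ?thesis by simp
qed

text \<open>For \<open>y = a\<close> the segment is constant. This identifies the values of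
  Hadamard's coefficients at \<open>a\<close> as the partial derivatives of the function
  there.\<close>

lemma radial_integral_centre: "radial_integral a 0 f a = f a"
  by (simp add: radial_integral_def segment_point_def)

section \<open>Smooth functions on a manifold\<close>

lemma smooth_nearI:
  assumes "openin (mtop M) W" "p \<in> W" "smooth_fun_on M W f"
  shows "f \<in> smooth_near M p"
  using assms unfolding smooth_near_def by blast

locale smooth_mfd =
  fixes M :: "'a mfd"
  assumes smooth_manifold: "smooth_manifold M"
begin

abbreviation "E \<equiv> Euclidean_space (mdim M)"

lemma
  assumes "(U, \<phi>) \<in> atlas M"
  shows chart_domain_open: "openin (mtop M) U"
    and chart_range_open: "openin E (\<phi> ` U)"
    and chart_homeomorphic: "homeomorphic_map (subtopology (mtop M) U) (subtopology E (\<phi> ` U)) \<phi>"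
  using smooth_manifold assms unfolding smooth_manifold_def is_chart_def by auto

lemma chart_inj:
  assumes "(U, \<phi>) \<in> atlas M"
  shows "inj_on \<phi> U"
  using homeomorphic_imp_injective_map[OF chart_homeomorphic[OF assms]]
    openin_subset[OF chart_domain_open[OF assms]] by (simp add: Int_absorb1)

lemma chart_inv: "(U, \<phi>) \<in> atlas M \<Longrightarrow> p \<in> U \<Longrightarrow> inv_into U \<phi> (\<phi> p) = p"
  by (simp add: chart_inj inv_into_f_f)

lemma chart_image_open:
  assumes c: "(U, \<phi>) \<in> atlas M" and W: "openin (mtop M) W"
  shows "openin E (\<phi> ` (U \<inter> W))"
proof -
  have "openin (subtopology (mtop M) U) (U \<inter> W)"
    using W by (auto simp: openin_subtopology)
  then have "openin (subtopology E (\<phi> ` U)) (\<phi> ` (U \<inter> W))"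
    using homeomorphic_imp_open_map[OF chart_homeomorphic[OF c]] by (simp add: open_map_def)
  then show ?thesis using chart_range_open[OF c] by (simp add: openin_open_subtopology)
qed

lemma chart_preimage_open:
  assumes c: "(U, \<phi>) \<in> atlas M" and B: "openin E B"
  shows "openin (mtop M) {q \<in> U. \<phi> q \<in> B}"
proof -
  have U: "U \<subseteq> pts M" using chart_domain_open[OF c] by (rule openin_subset)
  have "continuous_map (subtopology (mtop M) U) E \<phi>"
    using homeomorphic_imp_continuous_map[OF chart_homeomorphic[OF c]]
    by (simp add: continuous_map_in_subtopology)
  from openin_continuous_map_preimage[OF this B]
  have "openin (subtopology (mtop M) U) {q \<in> U. \<phi> q \<in> B}" using U by (simp add: Int_absorb1)
  then show ?thesis using chart_domain_open[OF c] by (simp add: openin_open_subtopology)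
qed

lemma smooth_fun_onI:
  "(\<And>U \<phi> k. (U, \<phi>) \<in> atlas M \<Longrightarrow> Ck_on (mdim M) k (\<phi> ` (U \<inter> W)) (\<lambda>x. f (inv_into U \<phi> x))) \<Longrightarrow>
    smooth_fun_on M W f"
  unfolding smooth_fun_on_def Cinf_on_def by auto

lemma smooth_fun_onD:
  "smooth_fun_on M W f \<Longrightarrow> (U, \<phi>) \<in> atlas M \<Longrightarrow> Ck_on (mdim M) k (\<phi> ` (U \<inter> W)) (\<lambda>x. f (inv_into U \<phi> x))"
  unfolding smooth_fun_on_def Cinf_on_def by auto

lemma smooth_fun_on_cong:
  assumes W: "openin (mtop M) W" and eq: "\<And>q. q \<in> W \<Longrightarrow> f q = g q" and f: "smooth_fun_on M W f"
  shows "smooth_fun_on M W g"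
proof (rule smooth_fun_onI)
  fix U \<phi> k assume c: "(U, \<phi>) \<in> atlas M"
  show "Ck_on (mdim M) k (\<phi> ` (U \<inter> W)) (\<lambda>x. g (inv_into U \<phi> x))"
    by (rule Ck_on_cong[OF chart_image_open[OF c W] _ smooth_fun_onD[OF f c]])
      (auto simp: chart_inv[OF c] eq)
qed

lemma smooth_fun_on_subset:
  assumes W: "openin (mtop M) W" and f: "smooth_fun_on M W f" and V: "V \<subseteq> W"
  shows "smooth_fun_on M V f"
proof (rule smooth_fun_onI)
  fix U \<phi> k assume c: "(U, \<phi>) \<in> atlas M"
  show "Ck_on (mdim M) k (\<phi> ` (U \<inter> V)) (\<lambda>x. f (inv_into U \<phi> x))"
    by (rule Ck_on_subset[OF smooth_fun_onD[OF f c] _ openin_subset[OF chart_image_open[OF c W]]])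
      (use V in auto)
qed

lemma smooth_fun_on_const: "openin (mtop M) W \<Longrightarrow> smooth_fun_on M W (\<lambda>q. c)"
  by (intro smooth_fun_onI Ck_on_const openin_subset chart_image_open)

lemma smooth_fun_on_add:
  "openin (mtop M) W \<Longrightarrow> smooth_fun_on M W f \<Longrightarrow> smooth_fun_on M W g \<Longrightarrow>
    smooth_fun_on M W (\<lambda>q. f q + g q)"
  by (rule smooth_fun_onI, rule Ck_on_add) (auto intro: chart_image_open smooth_fun_onD)

lemma smooth_fun_on_mult:
  "openin (mtop M) W \<Longrightarrow> smooth_fun_on M W f \<Longrightarrow> smooth_fun_on M W g \<Longrightarrow>
    smooth_fun_on M W (\<lambda>q. f q * g q)"
  by (rule smooth_fun_onI, rule Ck_on_mult) (auto intro: chart_image_open smooth_fun_onD)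

lemma smooth_fun_on_diff:
  assumes "openin (mtop M) W" "smooth_fun_on M W f" "smooth_fun_on M W g"
  shows "smooth_fun_on M W (\<lambda>q. f q - g q)"
  using smooth_fun_on_add[OF assms(1,2) smooth_fun_on_mult[OF assms(1) smooth_fun_on_const[OF assms(1), of "-1"] assms(3)]]
  by simp

text \<open>Read with one chart fixed and the other one varying, the compatibility condition of the
  atlas is exactly this.\<close>

lemma smooth_fun_on_coord:
  "(U, \<phi>) \<in> atlas M \<Longrightarrow> i < mdim M \<Longrightarrow> smooth_fun_on M U (\<lambda>q. \<phi> q i)"
  using smooth_manifold unfolding smooth_manifold_def smooth_fun_on_def by fast

text \<open>Hadamard's coefficients are constructed on a cube in a single chart. In any other chart
  they become composites with a transition map, so composition of C^k maps makes them smooth on the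
  manifold.\<close>

lemma smooth_fun_on_chart_pullback:
  assumes c: "(U, \<phi>) \<in> atlas M" and W: "openin (mtop M) W" "W \<subseteq> U"
    and B: "openin E B" "\<phi> ` W \<subseteq> B" and g: "\<And>k. Ck_on (mdim M) k B g"
  shows "smooth_fun_on M W (\<lambda>q. g (\<phi> q))"
proof (rule smooth_fun_onI)
  fix V \<psi> k assume d: "(V, \<psi>) \<in> atlas M"
  show "Ck_on (mdim M) k (\<psi> ` (V \<inter> W)) (\<lambda>x. g (\<phi> (inv_into V \<psi> x)))"
  proof (rule Ck_on_compose[OF chart_image_open[OF d W(1)] B(1) _ g])
    show "\<phi> (inv_into V \<psi> x) \<in> B" if "x \<in> \<psi> ` (V \<inter> W)" for x
      using that B(2) by (auto simp: chart_inv[OF d])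
    show "Ck_on (mdim M) k (\<psi> ` (V \<inter> W)) (\<lambda>x. \<phi> (inv_into V \<psi> x) i)" if "i < mdim M" for i
      using smooth_fun_onD[OF smooth_fun_on_subset[OF chart_domain_open[OF c]
        smooth_fun_on_coord[OF c that] W(2)] d] .
  qed
qed

lemma smooth_near_cong:
  assumes "f \<in> smooth_near M p" "openin (mtop M) W" "p \<in> W" "\<And>q. q \<in> W \<Longrightarrow> f q = g q"
  shows "g \<in> smooth_near M p"
proof -
  obtain V where V: "openin (mtop M) V" "p \<in> V" "smooth_fun_on M V f"
    using assms(1) unfolding smooth_near_def by blast
  have VW: "openin (mtop M) (V \<inter> W)" using V assms by blast
  show ?thesis
    by (rule smooth_nearI[OF VW _ smooth_fun_on_cong[OF VW _ smooth_fun_on_subset[OF V(1,3)]]])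
      (use V assms in auto)
qed

lemma
  assumes "f \<in> smooth_near M p" "g \<in> smooth_near M p"
  shows smooth_near_add: "(\<lambda>q. f q + g q) \<in> smooth_near M p"
    and smooth_near_mult: "(\<lambda>q. f q * g q) \<in> smooth_near M p"
proof -
  obtain V W where V: "openin (mtop M) V" "p \<in> V" "smooth_fun_on M V f"
    and W: "openin (mtop M) W" "p \<in> W" "smooth_fun_on M W g"
    using assms unfolding smooth_near_def by blast
  have VW: "openin (mtop M) (V \<inter> W)" "p \<in> V \<inter> W" using V W by blast+
  have "smooth_fun_on M (V \<inter> W) f" "smooth_fun_on M (V \<inter> W) g"
    using smooth_fun_on_subset[OF V(1,3)] smooth_fun_on_subset[OF W(1,3)] by auto
  then show "(\<lambda>q. f q + g q) \<in> smooth_near M p" "(\<lambda>q. f q * g q) \<in> smooth_near M p"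
    by (auto intro: smooth_nearI[OF VW] smooth_fun_on_add[OF VW(1)] smooth_fun_on_mult[OF VW(1)])
qed

lemma smooth_near_const: "p \<in> pts M \<Longrightarrow> (\<lambda>q. c) \<in> smooth_near M p"
  by (intro smooth_nearI[of M "pts M"] smooth_fun_on_const) auto

lemma smooth_near_cmult: "p \<in> pts M \<Longrightarrow> f \<in> smooth_near M p \<Longrightarrow> (\<lambda>q. c * f q) \<in> smooth_near M p"
  by (intro smooth_near_mult smooth_near_const)

lemma smooth_near_sum:
  "p \<in> pts M \<Longrightarrow> (\<And>i. i \<in> I \<Longrightarrow> f i \<in> smooth_near M p) \<Longrightarrow> (\<lambda>q. \<Sum>i\<in>I. f i q) \<in> smooth_near M p"
  by (induction I rule: infinite_finite_induct) (auto intro: smooth_near_const smooth_near_add)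

lemma smooth_near_coord:
  "(U, \<phi>) \<in> atlas M \<Longrightarrow> p \<in> U \<Longrightarrow> i < mdim M \<Longrightarrow> (\<lambda>q. \<phi> q i) \<in> smooth_near M p"
  by (rule smooth_nearI[OF chart_domain_open _ smooth_fun_on_coord])

section \<open>Tangent vectors\<close>

text \<open>The definition of a tangent vector compares two functions that are both smooth near
  \<open>p\<close>. Smoothness is local as well, so for \<open>g\<close> it is inherited from
  \<open>f\<close>.\<close>

lemma tangent_vectors_cong:
  assumes "v \<in> tangent_vectors M p" "f \<in> smooth_near M p"
    and "openin (mtop M) W" "p \<in> W" "\<And>q. q \<in> W \<Longrightarrow> f q = g q"
  shows "v f = v g"
proof -
  have "g \<in> smooth_near M p" using smooth_near_cong[OF assms(2-5)] .
  then show ?thesis using assms unfolding tangent_vectors_def by blast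
qed

lemma tangent_vectors_add:
  "v \<in> tangent_vectors M p \<Longrightarrow> f \<in> smooth_near M p \<Longrightarrow> g \<in> smooth_near M p \<Longrightarrow>
    v (\<lambda>q. f q + g q) = v f + v g"
  and tangent_vectors_mult:
  "v \<in> tangent_vectors M p \<Longrightarrow> f \<in> smooth_near M p \<Longrightarrow> g \<in> smooth_near M p \<Longrightarrow>
    v (\<lambda>q. f q * g q) = f p * v g + g p * v f"
  and tangent_vectors_cmult:
  "v \<in> tangent_vectors M p \<Longrightarrow> f \<in> smooth_near M p \<Longrightarrow> v (\<lambda>q. c * f q) = c * v f"
  unfolding tangent_vectors_def by blast+

text \<open>The Leibniz rule for \<open>1 = 1 * 1\<close> reads \<open>v(1) = v(1) + v(1)\<close>,
  and homogeneity passes from 1 to \<open>c\<close>.\<close>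

lemma tangent_vectors_const:
  assumes v: "v \<in> tangent_vectors M p" and p: "p \<in> pts M"
  shows "v (\<lambda>q. c) = 0"
proof -
  have "v (\<lambda>q. 1) = 0"
    using tangent_vectors_mult[OF v smooth_near_const[OF p] smooth_near_const[OF p], of 1 1] by simp
  then show ?thesis
    using tangent_vectors_cmult[OF v smooth_near_const[OF p], of c 1] by simp
qed

lemma tangent_vectors_diff:
  assumes v: "v \<in> tangent_vectors M p" and p: "p \<in> pts M"
    and f: "f \<in> smooth_near M p" and g: "g \<in> smooth_near M p"
  shows "v (\<lambda>q. f q - g q) = v f - v g"
  using tangent_vectors_add[OF v f smooth_near_cmult[OF p g, of "-1"]] tangent_vectors_cmult[OF v g, of "-1"]
  by simp

lemma tangent_vectors_sum:
  assumes v: "v \<in> tangent_vectors M p" and p: "p \<in> pts M"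
  shows "(\<And>i. i \<in> I \<Longrightarrow> f i \<in> smooth_near M p) \<Longrightarrow> v (\<lambda>q. \<Sum>i\<in>I. f i q) = (\<Sum>i\<in>I. v (f i))"
  by (induction I rule: infinite_finite_induct)
    (auto simp: tangent_vectors_const[OF v p] tangent_vectors_add[OF v] smooth_near_sum[OF p])

lemma tangent_vector_coordinates:
  assumes v: "v \<in> tangent_vectors M p" and c: "(U, \<phi>) \<in> atlas M" and p: "p \<in> U"
    and f: "f \<in> smooth_near M p"
  shows "v f = (\<Sum>i<mdim M. v (\<lambda>q. \<phi> q i) * partial i (\<lambda>x. f (inv_into U \<phi> x)) (\<phi> p))"
proof -
  define a where "a = \<phi> p"
  define F where "F x = f (inv_into U \<phi> x)" for x
  have pM: "p \<in> pts M" using openin_subset[OF chart_domain_open[OF c]] p by blast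
  obtain W where W: "openin (mtop M) W" "p \<in> W" "smooth_fun_on M W f"
    using f unfolding smooth_near_def by blast
  have oUW: "openin E (\<phi> ` (U \<inter> W))" and aUW: "a \<in> \<phi> ` (U \<inter> W)"
    using chart_image_open[OF c W(1)] p W(2) by (auto simp: a_def)
  then have aE: "a \<in> topspace E" using openin_subset by blast
  obtain e where e: "e > 0" "cube (mdim M) a e \<subseteq> \<phi> ` (U \<inter> W)"
    using openin_contains_cube[OF oUW aUW] .
  let ?B = "cube (mdim M) a e"
  have F: "Ck_on (mdim M) k ?B F" for k
    unfolding F_def by (rule Ck_on_subset[OF smooth_fun_onD[OF W(3) c] e(2) openin_subset[OF oUW]])
  define G where "G i = radial_integral a 0 (partial i F)" for i
  have G: "Ck_on (mdim M) k ?B (G i)" if "i < mdim M" for i k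
    unfolding G_def using F[of "Suc k"] that
    by (intro Ck_on_radial_integral[OF aE]) (simp add: Ck_on_Suc[OF cube_subset])
  define N where "N = {q \<in> U. \<phi> q \<in> ?B}"
  have N: "openin (mtop M) N" "N \<subseteq> U" "\<phi> ` N \<subseteq> ?B" "p \<in> N"
    using chart_preimage_open[OF c openin_cube] p centre_in_cube[OF aE e(1)] by (auto simp: N_def a_def)
  have coord: "(\<lambda>q. \<phi> q i) \<in> smooth_near M p" if "i < mdim M" for i
    by (rule smooth_near_coord[OF c p that])
  have diff: "(\<lambda>q. \<phi> q i + - a i) \<in> smooth_near M p" if "i < mdim M" for i
    by (rule smooth_near_add[OF coord[OF that] smooth_near_const[OF pM]])
  have g: "(\<lambda>q. G i (\<phi> q)) \<in> smooth_near M p" if "i < mdim M" for i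
    by (rule smooth_nearI[OF N(1,4) smooth_fun_on_chart_pullback[OF c N(1,2) openin_cube N(3)]])
      (rule G[OF that])
  have prod: "(\<lambda>q. (\<phi> q i + - a i) * G i (\<phi> q)) \<in> smooth_near M p" if "i < mdim M" for i
    by (rule smooth_near_mult[OF diff[OF that] g[OF that]])
  \<comment> \<open>Hadamard's expansion holds on \<open>N\<close> only, the part of the chart
    domain that is mapped into the cube. This suffices because \<open>v\<close> depends on the germ
    at \<open>p\<close>.\<close>
  have "f q = f p + (\<Sum>i<mdim M. (\<phi> q i + - a i) * G i (\<phi> q))" if "q \<in> N" for q
    using hadamard[OF aE F[of "Suc 0"], of "\<phi> q"] that p
    by (simp add: F_def G_def N_def a_def chart_inv[OF c])
  then have "v f = v (\<lambda>q. f p + (\<Sum>i<mdim M. (\<phi> q i + - a i) * G i (\<phi> q)))"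
    by (rule tangent_vectors_cong[OF v f N(1,4)])
  also have "\<dots> = v (\<lambda>q. f p) + v (\<lambda>q. \<Sum>i<mdim M. (\<phi> q i + - a i) * G i (\<phi> q))"
    using prod by (intro tangent_vectors_add[OF v] smooth_near_const[OF pM] smooth_near_sum[OF pM]) auto
  also have "\<dots> = (\<Sum>i<mdim M. v (\<lambda>q. (\<phi> q i + - a i) * G i (\<phi> q)))"
    using prod tangent_vectors_sum[OF v pM, of "{..<mdim M}" "\<lambda>i q. (\<phi> q i + - a i) * G i (\<phi> q)"]
    by (simp add: tangent_vectors_const[OF v pM])
  also have "\<dots> = (\<Sum>i<mdim M. v (\<lambda>q. \<phi> q i) * partial i F a)"
  proof (rule sum.cong)
    fix i assume "i \<in> {..<mdim M}"
    then have i: "i < mdim M" by simp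
    \<comment> \<open>The factor \<open>\<phi> q i + - a i\<close> vanishes at \<open>p\<close>, so
      the Leibniz term that differentiates \<open>G i\<close> drops out.\<close>
    have "v (\<lambda>q. (\<phi> q i + - a i) * G i (\<phi> q)) = G i (\<phi> p) * v (\<lambda>q. \<phi> q i + - a i)"
      using tangent_vectors_mult[OF v diff[OF i] g[OF i]] by (simp add: a_def)
    also have "v (\<lambda>q. \<phi> q i + - a i) = v (\<lambda>q. \<phi> q i) + v (\<lambda>q. - a i)"
      by (rule tangent_vectors_add[OF v coord[OF i] smooth_near_const[OF pM]])
    finally show "v (\<lambda>q. (\<phi> q i + - a i) * G i (\<phi> q)) = v (\<lambda>q. \<phi> q i) * partial i F a"
      by (simp add: tangent_vectors_const[OF v pM] G_def a_def[symmetric] radial_integral_centre mult.commute)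
  qed simp
  finally show ?thesis by (simp add: F_def[abs_def] a_def)
qed


section \<open>Vector fields and their bracket\<close>

lemma vfields_simps:
  "X \<oplus>\<^bsub>vfields M\<^esub> Y = (\<lambda>p\<in>pts M. \<lambda>f\<in>smooth_near M p. X p f + Y p f)"
  "f \<odot>\<^bsub>vfields M\<^esub> X = (\<lambda>p\<in>pts M. \<lambda>g\<in>smooth_near M p. f p * X p g)"
  "\<zero>\<^bsub>vfields M\<^esub> = (\<lambda>p\<in>pts M. \<lambda>f\<in>smooth_near M p. 0)"
  by (simp_all add: sections_def tangent_bundle_def tangent_space_def)

lemma vfields_carrier_iff:
  "X \<in> carrier (vfields M) \<longleftrightarrow>
    X \<in> extensional (pts M) \<and> (\<forall>p\<in>pts M. X p \<in> tangent_vectors M p) \<and>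
    (\<forall>(U, \<phi>)\<in>atlas M. \<forall>i<mdim M. smooth_fun_on M U (\<lambda>p. X p (\<lambda>q. \<phi> q i)))"
  by (auto simp: sections_def tangent_bundle_def tangent_space_def PiE_iff)

lemma vfield_tangent: "X \<in> carrier (vfields M) \<Longrightarrow> p \<in> pts M \<Longrightarrow> X p \<in> tangent_vectors M p"
  by (simp add: vfields_carrier_iff)

lemma vfield_smooth_coord:
  "X \<in> carrier (vfields M) \<Longrightarrow> (U, \<phi>) \<in> atlas M \<Longrightarrow> i < mdim M \<Longrightarrow>
    smooth_fun_on M U (\<lambda>p. X p (\<lambda>q. \<phi> q i))"
  by (auto simp: vfields_carrier_iff)

text \<open>Vector fields are extensional in the point and tangent vectors are extensional in the
  germ, so nothing outside the tested arguments can differ.\<close>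

lemma vfields_eqI:
  assumes "X \<in> carrier (vfields M)" "Y \<in> carrier (vfields M)"
    and "\<And>p f. p \<in> pts M \<Longrightarrow> f \<in> smooth_near M p \<Longrightarrow> X p f = Y p f"
  shows "X = Y"
proof (rule extensionalityI[of _ "pts M"])
  show "X p = Y p" if "p \<in> pts M" for p
    using vfield_tangent[OF assms(1) that] vfield_tangent[OF assms(2) that] assms(3)[OF that]
    by (intro extensionalityI[of _ "smooth_near M p"]) (auto simp: tangent_vectors_def)
qed (use assms in \<open>auto simp: vfields_carrier_iff\<close>)

text \<open>A smooth section of the tangent bundle is controlled on coordinate functions only. The
  coordinate formula expresses \<open>X(f)\<close> in a chart by the smooth components of
  \<open>X\<close> and the partial derivatives of \<open>f\<close>.\<close>

lemma vfield_smooth: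
  assumes X: "X \<in> carrier (vfields M)" and W: "openin (mtop M) W" and f: "smooth_fun_on M W f"
  shows "smooth_fun_on M W (\<lambda>p. X p f)"
proof (rule smooth_fun_onI)
  fix U \<phi> k assume c: "(U, \<phi>) \<in> atlas M"
  let ?V = "\<phi> ` (U \<inter> W)" and ?F = "\<lambda>x. f (inv_into U \<phi> x)"
  note V = chart_image_open[OF c W]
  show "Ck_on (mdim M) k ?V (\<lambda>x. X (inv_into U \<phi> x) f)"
  proof (rule Ck_on_cong[OF V])
    show "Ck_on (mdim M) k ?V
        (\<lambda>x. \<Sum>i<mdim M. X (inv_into U \<phi> x) (\<lambda>q. \<phi> q i) * partial i ?F x)"
    proof (rule Ck_on_sum[OF V], rule Ck_on_mult[OF V])
      fix i assume "i \<in> {..<mdim M}"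
      then have i: "i < mdim M" by simp
      have U: "\<phi> ` (U \<inter> U) \<subseteq> topspace E"
        using chart_range_open[OF c] by (simp add: openin_subset)
      show "Ck_on (mdim M) k ?V (\<lambda>x. X (inv_into U \<phi> x) (\<lambda>q. \<phi> q i))"
        by (rule Ck_on_subset[OF smooth_fun_onD[OF vfield_smooth_coord[OF X c i] c] _ U]) auto
      show "Ck_on (mdim M) k ?V (partial i ?F)"
        using smooth_fun_onD[OF f c, of "Suc k"] i by (simp add: Ck_on_Suc[OF openin_subset[OF V]])
    qed
    show "(\<Sum>i<mdim M. X (inv_into U \<phi> x) (\<lambda>q. \<phi> q i) * partial i ?F x) = X (inv_into U \<phi> x) f"
      if x: "x \<in> ?V" for x
    proof -
      obtain p where p: "p \<in> U" "p \<in> W" "x = \<phi> p" using x by blast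
      then have "p \<in> pts M" using openin_subset[OF W] by blast
      from tangent_vector_coordinates[OF vfield_tangent[OF X this] c p(1) smooth_nearI[OF W p(2) f]]
      show ?thesis using p by (simp add: chart_inv[OF c])
    qed
  qed
qed

lemma smooth_near_vfield:
  assumes "X \<in> carrier (vfields M)" "f \<in> smooth_near M p"
  shows "(\<lambda>q. X q f) \<in> smooth_near M p"
  using assms vfield_smooth unfolding smooth_near_def by blast

lemma vfield_cong_near:
  assumes X: "X \<in> carrier (vfields M)" and p: "p \<in> pts M" and g: "g \<in> smooth_near M p"
    and W: "openin (mtop M) W" "p \<in> W" "\<And>q. q \<in> W \<Longrightarrow> f q = g q"
  shows "X p f = X p g"
  by (rule sym) (rule tangent_vectors_cong[OF vfield_tangent[OF X p] g W(1,2) W(3)[symmetric]])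

text \<open>Smoothness near a point is an open condition: a neighbourhood that witnesses it for
  \<open>p\<close> witnesses it for each of its points.\<close>

lemma smooth_near_obtain:
  assumes "f \<in> smooth_near M p"
  obtains W where "openin (mtop M) W" "p \<in> W" "\<forall>q\<in>W. f \<in> smooth_near M q" "W \<subseteq> pts M"
proof -
  obtain W where W: "openin (mtop M) W" "p \<in> W" "smooth_fun_on M W f"
    using assms unfolding smooth_near_def by blast
  show ?thesis
    by (rule that[OF W(1,2) ballI openin_subset[OF W(1)]]) (rule smooth_nearI[OF W(1) _ W(3)])
qed

lemma smooth_near_obtain2:
  assumes "f \<in> smooth_near M p" "g \<in> smooth_near M p"
  obtains W where "openin (mtop M) W" "p \<in> W" "\<forall>q\<in>W. f \<in> smooth_near M q"
    "\<forall>q\<in>W. g \<in> smooth_near M q" "W \<subseteq> pts M"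
proof -
  obtain V where V: "openin (mtop M) V" "p \<in> V" "\<forall>q\<in>V. f \<in> smooth_near M q" "V \<subseteq> pts M"
    using smooth_near_obtain[OF assms(1)] .
  obtain W where W: "openin (mtop M) W" "p \<in> W" "\<forall>q\<in>W. g \<in> smooth_near M q" "W \<subseteq> pts M"
    using smooth_near_obtain[OF assms(2)] .
  show ?thesis by (rule that[of "V \<inter> W"]) (use V W in auto)
qed

text \<open>Additivity of \<open>Y\<close> is used at every \<open>q\<close> in a neighbourhood of
  \<open>p\<close>; only then is the resulting function differentiated by \<open>X\<close> at
  \<open>p\<close>. The same two stages recur for products and for congruence.\<close>

lemma vfield_iter_add:
  assumes X: "X \<in> carrier (vfields M)" and Y: "Y \<in> carrier (vfields M)" and p: "p \<in> pts M"
    and f: "f \<in> smooth_near M p" and g: "g \<in> smooth_near M p"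
  shows "X p (\<lambda>q. Y q (\<lambda>q. f q + g q)) = X p (\<lambda>q. Y q f) + X p (\<lambda>q. Y q g)"
proof -
  note Yf = smooth_near_vfield[OF Y f] and Yg = smooth_near_vfield[OF Y g]
  obtain W where W: "openin (mtop M) W" "p \<in> W" "\<forall>q\<in>W. f \<in> smooth_near M q"
    "\<forall>q\<in>W. g \<in> smooth_near M q" "W \<subseteq> pts M"
    using smooth_near_obtain2[OF f g] .
  have "X p (\<lambda>q. Y q (\<lambda>q. f q + g q)) = X p (\<lambda>q. Y q f + Y q g)"
    using W tangent_vectors_add[OF vfield_tangent[OF Y]]
    by (intro vfield_cong_near[OF X p smooth_near_add[OF Yf Yg] W(1,2)]) blast
  then show ?thesis using tangent_vectors_add[OF vfield_tangent[OF X p] Yf Yg] by simp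
qed

text \<open>The mixed terms \<open>Y p g * X p f\<close> and \<open>Y p f * X p g\<close> are
  interchanged when \<open>X\<close> and \<open>Y\<close> are. They cancel in the commutator, which
  is why the bracket is a derivation while the composite of \<open>X\<close> and \<open>Y\<close> is
  not.\<close>

lemma vfield_iter_mult:
  assumes X: "X \<in> carrier (vfields M)" and Y: "Y \<in> carrier (vfields M)" and p: "p \<in> pts M"
    and f: "f \<in> smooth_near M p" and g: "g \<in> smooth_near M p"
  shows "X p (\<lambda>q. Y q (\<lambda>q. f q * g q)) =
    f p * X p (\<lambda>q. Y q g) + Y p g * X p f + (g p * X p (\<lambda>q. Y q f) + Y p f * X p g)"
proof -
  note Yf = smooth_near_vfield[OF Y f] and Yg = smooth_near_vfield[OF Y g] and Xp = vfield_tangent[OF X p]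
  note fYg = smooth_near_mult[OF f Yg] and gYf = smooth_near_mult[OF g Yf]
  obtain W where W: "openin (mtop M) W" "p \<in> W" "\<forall>q\<in>W. f \<in> smooth_near M q"
    "\<forall>q\<in>W. g \<in> smooth_near M q" "W \<subseteq> pts M"
    using smooth_near_obtain2[OF f g] .
  have "X p (\<lambda>q. Y q (\<lambda>q. f q * g q)) = X p (\<lambda>q. f q * Y q g + g q * Y q f)"
    using W tangent_vectors_mult[OF vfield_tangent[OF Y]]
    by (intro vfield_cong_near[OF X p smooth_near_add[OF fYg gYf] W(1,2)]) blast
  then show ?thesis
    by (simp add: tangent_vectors_add[OF Xp fYg gYf] tangent_vectors_mult[OF Xp f Yg]
        tangent_vectors_mult[OF Xp g Yf])
qed

lemma vfield_iter_cong:
  assumes X: "X \<in> carrier (vfields M)" and Y: "Y \<in> carrier (vfields M)" and p: "p \<in> pts M"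
    and f: "f \<in> smooth_near M p" and W: "openin (mtop M) W" "p \<in> W" "\<And>q. q \<in> W \<Longrightarrow> f q = g q"
  shows "X p (\<lambda>q. Y q f) = X p (\<lambda>q. Y q g)"
proof -
  obtain V where V: "openin (mtop M) V" "p \<in> V" "\<forall>q\<in>V. f \<in> smooth_near M q" "V \<subseteq> pts M"
    using smooth_near_obtain[OF f] .
  have VW: "openin (mtop M) (V \<inter> W)" "p \<in> V \<inter> W" using V W by auto
  have "Y q f = Y q g" if q: "q \<in> V \<inter> W" for q
    using q V W(1,3) by (intro tangent_vectors_cong[OF vfield_tangent[OF Y] _ W(1)]) auto
  then show ?thesis
    by (rule tangent_vectors_cong[OF vfield_tangent[OF X p] smooth_near_vfield[OF Y f] VW])
qed

section \<open>The bracket of two vector fields is a vector field\<close>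

lemma bracket_app:
  "p \<in> pts M \<Longrightarrow> f \<in> smooth_near M p \<Longrightarrow>
    bracket M X Y p f = X p (\<lambda>q. Y q f) - Y p (\<lambda>q. X q f)"
  by (simp add: bracket_def)

lemma bracket_tangent:
  assumes X: "X \<in> carrier (vfields M)" and Y: "Y \<in> carrier (vfields M)" and p: "p \<in> pts M"
  shows "bracket M X Y p \<in> tangent_vectors M p"
  unfolding tangent_vectors_def
proof (intro CollectI conjI ballI allI impI)
  show "bracket M X Y p \<in> extensional (smooth_near M p)" using p by (simp add: bracket_def)
next
  fix f g assume f: "f \<in> smooth_near M p" and g: "g \<in> smooth_near M p"
  note app = bracket_app[OF p] and fg = smooth_near_add[OF f g] smooth_near_mult[OF f g]
  show "bracket M X Y p (\<lambda>q. f q + g q) = bracket M X Y p f + bracket M X Y p g"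
    by (simp add: app f g fg vfield_iter_add[OF X Y p f g] vfield_iter_add[OF Y X p f g])
  show "bracket M X Y p (\<lambda>q. f q * g q) = f p * bracket M X Y p g + g p * bracket M X Y p f"
    by (simp add: app f g fg vfield_iter_mult[OF X Y p f g] vfield_iter_mult[OF Y X p f g] algebra_simps)
  show "bracket M X Y p f = bracket M X Y p g"
    if "openin (mtop M) W \<and> p \<in> W \<and> (\<forall>q\<in>W. f q = g q)" for W
    using that vfield_iter_cong[OF X Y p f, of W g] vfield_iter_cong[OF Y X p f, of W g]
    by (simp add: app f g)
next
  fix c f assume f: "f \<in> smooth_near M p"
  \<comment> \<open>Homogeneity is obtained as the product rule with a constant factor, so every
    term in which the constant is differentiated has to vanish, once or twice iterated.\<close>
  have c: "(\<lambda>q. c) \<in> smooth_near M p" by (rule smooth_near_const[OF p])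
  have *: "X p (\<lambda>q. Y q (\<lambda>q. c)) = 0" if X: "X \<in> carrier (vfields M)" and Y: "Y \<in> carrier (vfields M)" for X Y
  proof -
    have "X p (\<lambda>q. Y q (\<lambda>q. c)) = X p (\<lambda>q. 0)"
      by (rule vfield_cong_near[OF X p smooth_near_const[OF p] openin_topspace p])
        (simp add: tangent_vectors_const[OF vfield_tangent[OF Y]])
    then show ?thesis by (simp add: tangent_vectors_const[OF vfield_tangent[OF X p] p])
  qed
  show "bracket M X Y p (\<lambda>q. c * f q) = c * bracket M X Y p f"
    by (simp add: bracket_app[OF p] f smooth_near_cmult[OF p f] vfield_iter_mult[OF X Y p c f]
        vfield_iter_mult[OF Y X p c f] *[OF X Y] *[OF Y X]
        tangent_vectors_const[OF vfield_tangent[OF X p] p]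
        tangent_vectors_const[OF vfield_tangent[OF Y p] p] algebra_simps)
qed

lemma bracket_closed:
  assumes X: "X \<in> carrier (vfields M)" and Y: "Y \<in> carrier (vfields M)"
  shows "bracket M X Y \<in> carrier (vfields M)"
  unfolding vfields_carrier_iff
proof (safe)
  show "bracket M X Y \<in> extensional (pts M)" by (simp add: bracket_def)
  show "bracket M X Y p \<in> tangent_vectors M p" if "p \<in> pts M" for p
    by (rule bracket_tangent[OF X Y that])
  fix U \<phi> i assume c: "(U, \<phi>) \<in> atlas M" and i: "i < mdim M"
  note U = chart_domain_open[OF c]
  have "smooth_fun_on M U (\<lambda>p. X p (\<lambda>q. Y q (\<lambda>q. \<phi> q i)) - Y p (\<lambda>q. X q (\<lambda>q. \<phi> q i)))"
    by (intro smooth_fun_on_diff[OF U] vfield_smooth[OF X U] vfield_smooth[OF Y U]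
      vfield_smooth_coord[OF X c i] vfield_smooth_coord[OF Y c i])
  then show "smooth_fun_on M U (\<lambda>p. bracket M X Y p (\<lambda>q. \<phi> q i))"
    by (rule smooth_fun_on_cong[OF U, rotated])
      (use openin_subset[OF U] smooth_near_coord[OF c _ i] in \<open>auto simp: bracket_app\<close>)
qed

section \<open>The module operations on vector fields\<close>

lemma vfields_add_app:
  "p \<in> pts M \<Longrightarrow> f \<in> smooth_near M p \<Longrightarrow> (X \<oplus>\<^bsub>vfields M\<^esub> Y) p f = X p f + Y p f"
  and vfields_smult_app:
  "p \<in> pts M \<Longrightarrow> f \<in> smooth_near M p \<Longrightarrow> (g \<odot>\<^bsub>vfields M\<^esub> X) p f = g p * X p f"
  and vfields_zero_app:
  "p \<in> pts M \<Longrightarrow> f \<in> smooth_near M p \<Longrightarrow> \<zero>\<^bsub>vfields M\<^esub> p f = 0"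
  by (simp_all add: vfields_simps)

text \<open>The combination \<open>a Y + b Z\<close> with smooth coefficients covers sums
  (\<open>a = b = 1\<close>) and multiples (\<open>b = 0\<close>), so the derivation property and
  smoothness are checked once for both.\<close>

lemma vfields_carrierI:
  assumes ext: "X \<in> extensional (pts M)" "\<And>p. p \<in> pts M \<Longrightarrow> X p \<in> extensional (smooth_near M p)"
    and eq: "\<And>p f. p \<in> pts M \<Longrightarrow> f \<in> smooth_near M p \<Longrightarrow> X p f = a p * Y p f + b p * Z p f"
    and Y: "Y \<in> carrier (vfields M)" and Z: "Z \<in> carrier (vfields M)"
    and a: "smooth_fun_on M (pts M) a" and b: "smooth_fun_on M (pts M) b"
  shows "X \<in> carrier (vfields M)"
  unfolding vfields_carrier_iff
proof (safe)
  fix p assume p: "p \<in> pts M"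
  note Yp = vfield_tangent[OF Y p] and Zp = vfield_tangent[OF Z p]
  show "X p \<in> tangent_vectors M p"
    unfolding tangent_vectors_def
  proof (intro CollectI conjI ballI allI impI)
    show "X p \<in> extensional (smooth_near M p)" using p by (rule ext)
  next
    fix f g assume f: "f \<in> smooth_near M p" and g: "g \<in> smooth_near M p"
    note app = eq[OF p] and fg = smooth_near_add[OF f g] smooth_near_mult[OF f g]
    show "X p (\<lambda>q. f q + g q) = X p f + X p g"
      by (simp add: app f g fg tangent_vectors_add[OF Yp f g] tangent_vectors_add[OF Zp f g] algebra_simps)
    show "X p (\<lambda>q. f q * g q) = f p * X p g + g p * X p f"
      by (simp add: app f g fg tangent_vectors_mult[OF Yp f g] tangent_vectors_mult[OF Zp f g] algebra_simps)
    show "X p f = X p g" if "openin (mtop M) W \<and> p \<in> W \<and> (\<forall>q\<in>W. f q = g q)" for W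
      using that tangent_vectors_cong[OF Yp f, of W g] tangent_vectors_cong[OF Zp f, of W g]
      by (simp add: app f g)
  next
    fix c f assume f: "f \<in> smooth_near M p"
    show "X p (\<lambda>q. c * f q) = c * X p f"
      by (simp add: eq[OF p] f smooth_near_cmult[OF p f] tangent_vectors_cmult[OF Yp f]
          tangent_vectors_cmult[OF Zp f] algebra_simps)
  qed
next
  fix U \<phi> i assume c: "(U, \<phi>) \<in> atlas M" and i: "i < mdim M"
  note U = chart_domain_open[OF c]
  note sub = smooth_fun_on_subset[OF openin_topspace _ openin_subset[OF U]]
  have "smooth_fun_on M U (\<lambda>p. a p * Y p (\<lambda>q. \<phi> q i) + b p * Z p (\<lambda>q. \<phi> q i))"
    by (intro smooth_fun_on_add[OF U] smooth_fun_on_mult[OF U] sub a b vfield_smooth_coord[OF Y c i]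
      vfield_smooth_coord[OF Z c i])
  then show "smooth_fun_on M U (\<lambda>p. X p (\<lambda>q. \<phi> q i))"
    by (rule smooth_fun_on_cong[OF U, rotated])
      (use openin_subset[OF U] smooth_near_coord[OF c _ i] in \<open>auto simp: eq\<close>)
qed (rule ext)

lemma vfields_zero_closed: "\<zero>\<^bsub>vfields M\<^esub> \<in> carrier (vfields M)"
  unfolding vfields_carrier_iff
proof (safe)
  fix p assume p: "p \<in> pts M"
  then show "\<zero>\<^bsub>vfields M\<^esub> p \<in> tangent_vectors M p"
    by (auto simp: tangent_vectors_def vfields_simps smooth_near_add smooth_near_mult smooth_near_cmult)
next
  fix U \<phi> i assume c: "(U, \<phi>) \<in> atlas M" and i: "i < mdim M"
  note U = chart_domain_open[OF c]
  show "smooth_fun_on M U (\<lambda>p. \<zero>\<^bsub>vfields M\<^esub> p (\<lambda>q. \<phi> q i))"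
    by (rule smooth_fun_on_cong[OF U _ smooth_fun_on_const[OF U, of 0]])
      (use openin_subset[OF U] smooth_near_coord[OF c _ i] in \<open>auto simp: vfields_zero_app\<close>)
qed (simp add: vfields_simps)

lemma vfields_add_closed:
  assumes "X \<in> carrier (vfields M)" "Y \<in> carrier (vfields M)"
  shows "X \<oplus>\<^bsub>vfields M\<^esub> Y \<in> carrier (vfields M)"
  by (rule vfields_carrierI[of _ "\<lambda>p. 1" X "\<lambda>p. 1" Y])
    (use assms in \<open>auto simp: vfields_simps smooth_fun_on_const\<close>)

lemma vfields_smult_closed:
  assumes "f \<in> carrier (smooth_ring M)" "X \<in> carrier (vfields M)"
  shows "f \<odot>\<^bsub>vfields M\<^esub> X \<in> carrier (vfields M)"
  by (rule vfields_carrierI[of _ f X "\<lambda>p. 0" X])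
    (use assms in \<open>auto simp: vfields_simps smooth_fun_on_const smooth_ring_def\<close>)


section \<open>The ring of smooth functions and the action of vector fields on it\<close>

lemma smooth_ring_simps:
  "f \<oplus>\<^bsub>smooth_ring M\<^esub> g = (\<lambda>p\<in>pts M. f p + g p)"
  "f \<otimes>\<^bsub>smooth_ring M\<^esub> g = (\<lambda>p\<in>pts M. f p * g p)"
  "\<zero>\<^bsub>smooth_ring M\<^esub> = (\<lambda>p\<in>pts M. 0)"
  by (simp_all add: smooth_ring_def)

lemma smooth_ring_carrier_iff:
  "f \<in> carrier (smooth_ring M) \<longleftrightarrow> f \<in> extensional (pts M) \<and> smooth_fun_on M (pts M) f"
  by (simp add: smooth_ring_def)

lemma restrict_smooth_ring:
  "smooth_fun_on M (pts M) f \<Longrightarrow> restrict f (pts M) \<in> carrier (smooth_ring M)"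
  by (auto simp: smooth_ring_carrier_iff intro: smooth_fun_on_cong[OF openin_topspace, of f])

lemma const_fun_closed: "const_fun M c \<in> carrier (smooth_ring M)"
  unfolding const_fun_def by (intro restrict_smooth_ring smooth_fun_on_const openin_topspace)

lemma const_fun_app: "p \<in> pts M \<Longrightarrow> const_fun M c p = c"
  by (simp add: const_fun_def)

lemma
  assumes "f \<in> carrier (smooth_ring M)" "g \<in> carrier (smooth_ring M)"
  shows smooth_ring_add_closed: "f \<oplus>\<^bsub>smooth_ring M\<^esub> g \<in> carrier (smooth_ring M)"
    and smooth_ring_mult_closed: "f \<otimes>\<^bsub>smooth_ring M\<^esub> g \<in> carrier (smooth_ring M)"
  unfolding smooth_ring_simps using assms
  by (intro restrict_smooth_ring smooth_fun_on_add smooth_fun_on_mult openin_topspace;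
      simp add: smooth_ring_carrier_iff)+

lemma smooth_ring_near: "f \<in> carrier (smooth_ring M) \<Longrightarrow> p \<in> pts M \<Longrightarrow> f \<in> smooth_near M p"
  by (rule smooth_nearI[OF openin_topspace]) (auto simp: smooth_ring_carrier_iff)

lemma vf_app_closed:
  "X \<in> carrier (vfields M) \<Longrightarrow> f \<in> carrier (smooth_ring M) \<Longrightarrow> vf_app M X f \<in> carrier (smooth_ring M)"
  unfolding vf_app_def
  by (rule restrict_smooth_ring, rule vfield_smooth) (auto simp: smooth_ring_carrier_iff)

lemma vf_app_app: "p \<in> pts M \<Longrightarrow> vf_app M X f p = X p f"
  by (simp add: vf_app_def)

text \<open>The manifold itself is a neighbourhood of \<open>p\<close>, so values off
  \<open>pts M\<close> are invisible to \<open>X\<close>. This permits differentiating the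
  extensional functions of \<open>smooth_ring M\<close> by formulas that hold on
  \<open>pts M\<close> only.\<close>

lemma vfield_cong:
  assumes "X \<in> carrier (vfields M)" "p \<in> pts M" "g \<in> smooth_near M p" "\<And>q. q \<in> pts M \<Longrightarrow> f q = g q"
  shows "X p f = X p g"
  by (rule vfield_cong_near[OF assms(1-3) openin_topspace assms(2,4)])

text \<open>The shape of \<open>h\<close> is that of
  \<open>nabla X (f s) = X(f) P(s) + f nabla X s\<close>, the expression that the curvature
  differentiates once more.\<close>

lemma vfield_leibniz:
  assumes X: "X \<in> carrier (vfields M)" and p: "p \<in> pts M"
    and near: "a \<in> smooth_near M p" "b \<in> smooth_near M p" "c \<in> smooth_near M p" "d \<in> smooth_near M p"
    and h: "\<And>q. q \<in> pts M \<Longrightarrow> h q = a q * b q + c q * d q"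
  shows "X p h = a p * X p b + b p * X p a + c p * X p d + d p * X p c"
proof -
  note ab = smooth_near_mult[OF near(1,2)] and cd = smooth_near_mult[OF near(3,4)]
    and v = vfield_tangent[OF X p]
  have "X p h = X p (\<lambda>q. a q * b q + c q * d q)"
    by (rule vfield_cong[OF X p smooth_near_add[OF ab cd] h])
  then show ?thesis
    by (simp add: tangent_vectors_add[OF v ab cd] tangent_vectors_mult[OF v near(1,2)]
        tangent_vectors_mult[OF v near(3,4)])
qed

lemma vfield_sum:
  assumes X: "X \<in> carrier (vfields M)" and p: "p \<in> pts M"
    and near: "a \<in> smooth_near M p" "b \<in> smooth_near M p"
    and h: "\<And>q. q \<in> pts M \<Longrightarrow> h q = a q + b q"
  shows "X p h = X p a + X p b"
  by (rule trans[OF vfield_cong[OF X p smooth_near_add[OF near] h]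
        tangent_vectors_add[OF vfield_tangent[OF X p] near]])

lemma vfield_prod:
  assumes X: "X \<in> carrier (vfields M)" and p: "p \<in> pts M"
    and near: "a \<in> smooth_near M p" "b \<in> smooth_near M p"
    and h: "\<And>q. q \<in> pts M \<Longrightarrow> h q = a q * b q"
  shows "X p h = a p * X p b + b p * X p a"
  by (rule trans[OF vfield_cong[OF X p smooth_near_mult[OF near] h]
        tangent_vectors_mult[OF vfield_tangent[OF X p] near]])

lemma vfield_difference:
  assumes X: "X \<in> carrier (vfields M)" and p: "p \<in> pts M"
    and near: "a \<in> smooth_near M p" "b \<in> smooth_near M p"
    and h: "\<And>q. q \<in> pts M \<Longrightarrow> h q = a q - b q"
  shows "X p h = X p a - X p b"
proof -
  have "X p a = X p h + X p b"
  proof (rule vfield_sum[OF X p])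
    show "h \<in> smooth_near M p"
      by (rule smooth_near_cong[OF smooth_near_add[OF near(1) smooth_near_cmult[OF p near(2), of "-1"]] openin_topspace p])
        (simp add: h)
  qed (simp_all add: near h)
  then show ?thesis by simp
qed

lemma vfields_abelian_group: "abelian_group (vfields M)"
proof (rule abelian_groupI)
  show "\<exists>Y\<in>carrier (vfields M). Y \<oplus>\<^bsub>vfields M\<^esub> X = \<zero>\<^bsub>vfields M\<^esub>" if X: "X \<in> carrier (vfields M)" for X
  proof
    show Y: "const_fun M (-1) \<odot>\<^bsub>vfields M\<^esub> X \<in> carrier (vfields M)"
      by (rule vfields_smult_closed[OF const_fun_closed X])
    show "(const_fun M (-1) \<odot>\<^bsub>vfields M\<^esub> X) \<oplus>\<^bsub>vfields M\<^esub> X = \<zero>\<^bsub>vfields M\<^esub>"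
      by (rule vfields_eqI[OF vfields_add_closed[OF Y X] vfields_zero_closed])
        (simp add: vfields_add_app vfields_smult_app vfields_zero_app const_fun_app)
  qed
qed (auto intro!: vfields_eqI intro: vfields_add_closed vfields_zero_closed simp: vfields_add_app vfields_zero_app)

text \<open>Subtraction is defined through the abstract additive inverse. Uniqueness of inverses
  identifies it with multiplication by the constant -1, a form in which both evaluation at a point
  and the linearity rules of \<open>nabla\<close> apply.\<close>

lemma vfields_minus_eq:
  assumes X: "X \<in> carrier (vfields M)" and Y: "Y \<in> carrier (vfields M)"
  shows "X \<ominus>\<^bsub>vfields M\<^esub> Y = X \<oplus>\<^bsub>vfields M\<^esub> (const_fun M (-1) \<odot>\<^bsub>vfields M\<^esub> Y)"
proof -
  interpret V: abelian_group "vfields M" by (rule vfields_abelian_group)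
  have Y': "const_fun M (-1) \<odot>\<^bsub>vfields M\<^esub> Y \<in> carrier (vfields M)"
    by (rule vfields_smult_closed[OF const_fun_closed Y])
  have "(const_fun M (-1) \<odot>\<^bsub>vfields M\<^esub> Y) \<oplus>\<^bsub>vfields M\<^esub> Y = \<zero>\<^bsub>vfields M\<^esub>"
    by (rule vfields_eqI[OF vfields_add_closed[OF Y' Y] vfields_zero_closed])
      (simp add: vfields_add_app vfields_smult_app vfields_zero_app const_fun_app)
  then have "\<ominus>\<^bsub>vfields M\<^esub> Y = const_fun M (-1) \<odot>\<^bsub>vfields M\<^esub> Y"
    by (rule V.minus_equality[OF _ Y Y'])
  then show ?thesis by (simp add: a_minus_def)
qed

lemma vfields_minus_closed:
  "X \<in> carrier (vfields M) \<Longrightarrow> Y \<in> carrier (vfields M) \<Longrightarrow> X \<ominus>\<^bsub>vfields M\<^esub> Y \<in> carrier (vfields M)"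
  using abelian_group.minus_closed[OF vfields_abelian_group] by blast

lemma vfields_minus_app:
  "X \<in> carrier (vfields M) \<Longrightarrow> Y \<in> carrier (vfields M) \<Longrightarrow> p \<in> pts M \<Longrightarrow> f \<in> smooth_near M p \<Longrightarrow>
    (X \<ominus>\<^bsub>vfields M\<^esub> Y) p f = X p f - Y p f"
  by (simp add: vfields_minus_eq vfields_add_app vfields_smult_app const_fun_app)

section \<open>Algebraic rules for the bracket\<close>

lemma bracket_add_left:
  assumes X: "X \<in> carrier (vfields M)" and X': "X' \<in> carrier (vfields M)" and Y: "Y \<in> carrier (vfields M)"
  shows "bracket M (X \<oplus>\<^bsub>vfields M\<^esub> X') Y = bracket M X Y \<oplus>\<^bsub>vfields M\<^esub> bracket M X' Y"
proof (rule vfields_eqI)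
  fix p f assume p: "p \<in> pts M" and f: "f \<in> smooth_near M p"
  obtain W where W: "openin (mtop M) W" "p \<in> W" "\<forall>q\<in>W. f \<in> smooth_near M q" "W \<subseteq> pts M"
    using smooth_near_obtain[OF f] .
  note nX = smooth_near_vfield[OF X f] and nX' = smooth_near_vfield[OF X' f]
  have "Y p (\<lambda>q. (X \<oplus>\<^bsub>vfields M\<^esub> X') q f) = Y p (\<lambda>q. X q f + X' q f)"
    by (rule vfield_cong_near[OF Y p smooth_near_add[OF nX nX'] W(1,2)])
      (use W in \<open>auto simp: vfields_add_app\<close>)
  then show "bracket M (X \<oplus>\<^bsub>vfields M\<^esub> X') Y p f = (bracket M X Y \<oplus>\<^bsub>vfields M\<^esub> bracket M X' Y) p f"
    by (simp add: bracket_app p f vfields_add_app smooth_near_vfield[OF Y f]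
        tangent_vectors_add[OF vfield_tangent[OF Y p] nX nX'])
qed (intro bracket_closed vfields_add_closed X X' Y)+

text \<open>In \<open>Y(g X(f))\<close> the field \<open>Y\<close> also differentiates the
  coefficient \<open>g\<close>, which accounts for the subtracted term.\<close>

lemma bracket_smult_left:
  assumes X: "X \<in> carrier (vfields M)" and Y: "Y \<in> carrier (vfields M)" and g: "g \<in> carrier (smooth_ring M)"
  shows "bracket M (g \<odot>\<^bsub>vfields M\<^esub> X) Y =
    (g \<odot>\<^bsub>vfields M\<^esub> bracket M X Y) \<ominus>\<^bsub>vfields M\<^esub> (vf_app M Y g \<odot>\<^bsub>vfields M\<^esub> X)"
proof (rule vfields_eqI)
  note cl = bracket_closed[OF X Y] vfields_smult_closed[OF g bracket_closed[OF X Y]]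
    vfields_smult_closed[OF vf_app_closed[OF Y g] X]
  show "g \<odot>\<^bsub>vfields M\<^esub> bracket M X Y \<ominus>\<^bsub>vfields M\<^esub> vf_app M Y g \<odot>\<^bsub>vfields M\<^esub> X \<in> carrier (vfields M)"
    by (intro vfields_minus_closed cl)
  fix p f assume p: "p \<in> pts M" and f: "f \<in> smooth_near M p"
  obtain W where W: "openin (mtop M) W" "p \<in> W" "\<forall>q\<in>W. f \<in> smooth_near M q" "W \<subseteq> pts M"
    using smooth_near_obtain[OF f] .
  note nX = smooth_near_vfield[OF X f] and ng = smooth_ring_near[OF g p]
  have "Y p (\<lambda>q. (g \<odot>\<^bsub>vfields M\<^esub> X) q f) = Y p (\<lambda>q. g q * X q f)"
    by (rule vfield_cong_near[OF Y p smooth_near_mult[OF ng nX] W(1,2)])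
      (use W in \<open>auto simp: vfields_smult_app\<close>)
  then show "bracket M (g \<odot>\<^bsub>vfields M\<^esub> X) Y p f =
      (g \<odot>\<^bsub>vfields M\<^esub> bracket M X Y \<ominus>\<^bsub>vfields M\<^esub> vf_app M Y g \<odot>\<^bsub>vfields M\<^esub> X) p f"
    by (simp add: bracket_app p f vfields_minus_app cl vfields_smult_app smooth_near_vfield[OF Y f]
        tangent_vectors_mult[OF vfield_tangent[OF Y p] ng nX] vf_app_app algebra_simps)
qed (intro bracket_closed vfields_smult_closed X Y g)

lemma bracket_antisym:
  assumes X: "X \<in> carrier (vfields M)" and Y: "Y \<in> carrier (vfields M)"
  shows "bracket M X Y = const_fun M (-1) \<odot>\<^bsub>vfields M\<^esub> bracket M Y X"
  by (rule vfields_eqI[OF bracket_closed[OF X Y] vfields_smult_closed[OF const_fun_closed bracket_closed[OF Y X]]])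
    (simp add: bracket_app vfields_smult_app const_fun_app)

lemma bracket_bracket_app:
  assumes X: "X \<in> carrier (vfields M)" and Y: "Y \<in> carrier (vfields M)" and Z: "Z \<in> carrier (vfields M)"
    and p: "p \<in> pts M" and f: "f \<in> smooth_near M p"
  shows "bracket M X (bracket M Y Z) p f =
    X p (\<lambda>q. Y q (\<lambda>q. Z q f)) - X p (\<lambda>q. Z q (\<lambda>q. Y q f)) -
    (Y p (\<lambda>q. Z q (\<lambda>q. X q f)) - Z p (\<lambda>q. Y q (\<lambda>q. X q f)))"
proof -
  obtain W where W: "openin (mtop M) W" "p \<in> W" "\<forall>q\<in>W. f \<in> smooth_near M q" "W \<subseteq> pts M"
    using smooth_near_obtain[OF f] .
  note nYZ = smooth_near_vfield[OF Y smooth_near_vfield[OF Z f]]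
    and nZY = smooth_near_vfield[OF Z smooth_near_vfield[OF Y f]]
  have near: "(\<lambda>q. bracket M Y Z q f) \<in> smooth_near M p"
    by (rule smooth_near_vfield[OF bracket_closed[OF Y Z] f])
  have "X p (\<lambda>q. bracket M Y Z q f) = X p (\<lambda>q. Y q (\<lambda>q. Z q f) - Z q (\<lambda>q. Y q f))"
    by (rule tangent_vectors_cong[OF vfield_tangent[OF X p] near W(1,2)])
      (use W in \<open>auto simp: bracket_app\<close>)
  then show ?thesis
    by (simp add: bracket_app p f smooth_near_vfield[OF X f]
        tangent_vectors_diff[OF vfield_tangent[OF X p] p nYZ nZY])
qed

text \<open>Expanded, the sum has twelve threefold derivatives of \<open>f\<close>: each of the six
  orders of \<open>X\<close>, \<open>Y\<close>, \<open>Z\<close> occurs twice, with opposite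
  signs.\<close>

lemma jacobi:
  assumes "X \<in> carrier (vfields M)" "Y \<in> carrier (vfields M)" "Z \<in> carrier (vfields M)"
  shows "bracket M X (bracket M Y Z) \<oplus>\<^bsub>vfields M\<^esub> bracket M Y (bracket M Z X)
    \<oplus>\<^bsub>vfields M\<^esub> bracket M Z (bracket M X Y) = \<zero>\<^bsub>vfields M\<^esub>"
  by (rule vfields_eqI)
    (simp_all add: assms bracket_closed vfields_add_closed vfields_zero_closed vfields_add_app
      vfields_zero_app bracket_bracket_app)

section \<open>The modules \<open>\<DD>\<^sup>k(M)\<close>\<close>

lemma DD_carrier_iff:
  "d \<in> carrier (DD M k) \<longleftrightarrow>
    d \<in> extensional (vf_tuples M k) \<and> (\<forall>Xs\<in>vf_tuples M k. d Xs \<in> carrier (smooth_ring M))"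
  by (auto simp: DD_def PiE_iff)

lemma DD_simps:
  "d \<oplus>\<^bsub>DD M k\<^esub> e = (\<lambda>Xs\<in>vf_tuples M k. d Xs \<oplus>\<^bsub>smooth_ring M\<^esub> e Xs)"
  "f \<odot>\<^bsub>DD M k\<^esub> d = (\<lambda>Xs\<in>vf_tuples M k. f \<otimes>\<^bsub>smooth_ring M\<^esub> d Xs)"
  "\<zero>\<^bsub>DD M k\<^esub> = (\<lambda>Xs\<in>vf_tuples M k. \<zero>\<^bsub>smooth_ring M\<^esub>)"
  by (simp_all add: DD_def)

text \<open>The two modules differ in their carriers only, so the rules of a pseudoconnection,
  stated with the operations of \<open>DD0 M k\<close>, can be read in
  \<open>DD M k\<close>.\<close>

lemma DD0_simps:
  "d \<oplus>\<^bsub>DD0 M k\<^esub> e = d \<oplus>\<^bsub>DD M k\<^esub> e" "f \<odot>\<^bsub>DD0 M k\<^esub> d = f \<odot>\<^bsub>DD M k\<^esub> d" "\<zero>\<^bsub>DD0 M k\<^esub> = \<zero>\<^bsub>DD M k\<^esub>"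
  by (simp_all add: DD0_def)

lemma DD0_subset: "d \<in> carrier (DD0 M k) \<Longrightarrow> d \<in> carrier (DD M k)"
  by (simp add: DD0_def)

lemma DD_app_closed: "d \<in> carrier (DD M k) \<Longrightarrow> Xs \<in> vf_tuples M k \<Longrightarrow> d Xs \<in> carrier (smooth_ring M)"
  by (simp add: DD_carrier_iff)

lemma DD_near:
  "d \<in> carrier (DD M k) \<Longrightarrow> Xs \<in> vf_tuples M k \<Longrightarrow> p \<in> pts M \<Longrightarrow> d Xs \<in> smooth_near M p"
  by (intro smooth_ring_near DD_app_closed)

lemma DD_add_app:
  "Xs \<in> vf_tuples M k \<Longrightarrow> p \<in> pts M \<Longrightarrow> (d \<oplus>\<^bsub>DD M k\<^esub> e) Xs p = d Xs p + e Xs p"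
  and DD_smult_app:
  "Xs \<in> vf_tuples M k \<Longrightarrow> p \<in> pts M \<Longrightarrow> (f \<odot>\<^bsub>DD M k\<^esub> d) Xs p = f p * d Xs p"
  and DD_zero_app: "Xs \<in> vf_tuples M k \<Longrightarrow> p \<in> pts M \<Longrightarrow> \<zero>\<^bsub>DD M k\<^esub> Xs p = 0"
  by (simp_all add: DD_simps smooth_ring_simps)

lemma DD_eqI:
  assumes "d \<in> carrier (DD M k)" "e \<in> carrier (DD M k)"
    and "\<And>Xs p. Xs \<in> vf_tuples M k \<Longrightarrow> p \<in> pts M \<Longrightarrow> d Xs p = e Xs p"
  shows "d = e"
proof (rule extensionalityI[of _ "vf_tuples M k"])
  show "d Xs = e Xs" if "Xs \<in> vf_tuples M k" for Xs
    using assms(1,2) that assms(3)[OF that]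
    by (intro extensionalityI[of _ "pts M"]) (auto simp: DD_carrier_iff smooth_ring_carrier_iff)
qed (use assms in \<open>auto simp: DD_carrier_iff\<close>)

lemma DD_add_closed: "d \<in> carrier (DD M k) \<Longrightarrow> e \<in> carrier (DD M k) \<Longrightarrow> d \<oplus>\<^bsub>DD M k\<^esub> e \<in> carrier (DD M k)"
  and DD_smult_closed:
  "f \<in> carrier (smooth_ring M) \<Longrightarrow> d \<in> carrier (DD M k) \<Longrightarrow> f \<odot>\<^bsub>DD M k\<^esub> d \<in> carrier (DD M k)"
  by (auto simp: DD_carrier_iff DD_simps intro: smooth_ring_add_closed smooth_ring_mult_closed)

lemma DD_zero_closed: "\<zero>\<^bsub>DD M k\<^esub> \<in> carrier (DD M k)"
  using const_fun_closed[of 0] by (auto simp: DD_carrier_iff DD_simps smooth_ring_simps const_fun_def)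

lemma DD_abelian_group: "abelian_group (DD M k)"
proof (rule abelian_groupI)
  show "\<exists>e\<in>carrier (DD M k). e \<oplus>\<^bsub>DD M k\<^esub> d = \<zero>\<^bsub>DD M k\<^esub>" if d: "d \<in> carrier (DD M k)" for d
  proof
    show e: "const_fun M (-1) \<odot>\<^bsub>DD M k\<^esub> d \<in> carrier (DD M k)"
      by (rule DD_smult_closed[OF const_fun_closed d])
    show "(const_fun M (-1) \<odot>\<^bsub>DD M k\<^esub> d) \<oplus>\<^bsub>DD M k\<^esub> d = \<zero>\<^bsub>DD M k\<^esub>"
      by (rule DD_eqI[OF DD_add_closed[OF e d] DD_zero_closed])
        (simp add: DD_add_app DD_smult_app DD_zero_app const_fun_app)
  qed
qed (auto intro!: DD_eqI intro: DD_add_closed DD_zero_closed simp: DD_add_app DD_zero_app)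

lemma DD_uminus_closed: "d \<in> carrier (DD M k) \<Longrightarrow> \<ominus>\<^bsub>DD M k\<^esub> d \<in> carrier (DD M k)"
  by (rule abelian_group.a_inv_closed[OF DD_abelian_group])

lemma DD_uminus_app:
  assumes "d \<in> carrier (DD M k)" "Xs \<in> vf_tuples M k" "p \<in> pts M"
  shows "(\<ominus>\<^bsub>DD M k\<^esub> d) Xs p = - d Xs p"
  using DD_add_app[OF assms(2,3), of "\<ominus>\<^bsub>DD M k\<^esub> d" d] DD_zero_app[OF assms(2,3)]
    abelian_group.l_neg[OF DD_abelian_group assms(1)] by simp

lemma DD_minus_closed:
  "d \<in> carrier (DD M k) \<Longrightarrow> e \<in> carrier (DD M k) \<Longrightarrow> d \<ominus>\<^bsub>DD M k\<^esub> e \<in> carrier (DD M k)"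
  by (rule abelian_group.minus_closed[OF DD_abelian_group])

lemma DD_minus_app:
  "e \<in> carrier (DD M k) \<Longrightarrow> Xs \<in> vf_tuples M k \<Longrightarrow> p \<in> pts M \<Longrightarrow>
    (d \<ominus>\<^bsub>DD M k\<^esub> e) Xs p = d Xs p - e Xs p"
  by (simp add: a_minus_def DD_add_app DD_uminus_app)

text \<open>Torsion freeness subtracts in \<open>DD0 M k\<close>, where the inverse is taken within
  the smaller carrier and so is not by definition the inverse in \<open>DD M k\<close>. Evaluating
  \<open>- e + e = 0\<close>, whose sum and zero the two modules share, shows that it is the
  pointwise negative.\<close>

lemma DD0_minus_app:
  assumes "abelian_group (DD0 M k)" "e \<in> carrier (DD0 M k)" "Xs \<in> vf_tuples M k" "p \<in> pts M"
  shows "(d \<ominus>\<^bsub>DD0 M k\<^esub> e) Xs p = d Xs p - e Xs p"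
proof -
  have "(\<ominus>\<^bsub>DD0 M k\<^esub> e) \<oplus>\<^bsub>DD M k\<^esub> e = \<zero>\<^bsub>DD M k\<^esub>"
    using abelian_group.l_neg[OF assms(1,2)] by (simp add: DD0_simps)
  then have "(\<ominus>\<^bsub>DD0 M k\<^esub> e) Xs p + e Xs p = 0"
    using DD_add_app[OF assms(3,4), of "\<ominus>\<^bsub>DD0 M k\<^esub> e" e] DD_zero_app[OF assms(3,4)] by simp
  then show ?thesis by (simp add: a_minus_def DD0_simps DD_add_app assms)
qed

lemma vf_appD_closed:
  "X \<in> carrier (vfields M) \<Longrightarrow> d \<in> carrier (DD M k) \<Longrightarrow> vf_appD M k X d \<in> carrier (DD M k)"
  by (auto simp: DD_carrier_iff vf_appD_def intro: vf_app_closed)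

lemma vf_appD_app: "Xs \<in> vf_tuples M k \<Longrightarrow> p \<in> pts M \<Longrightarrow> vf_appD M k X d Xs p = X p (d Xs)"
  by (simp add: vf_appD_def vf_app_app)

end

section \<open>Curvature of a pseudoconnection\<close>

locale pseudoconn = smooth_mfd M for M :: "'a mfd" +
  fixes \<xi> :: "('a, 'v) vbundle" and k :: nat
    and nabla :: "'a vfield \<Rightarrow> ('a \<Rightarrow> 'v) \<Rightarrow> 'a vfield list \<Rightarrow> 'a \<Rightarrow> real"
    and P :: "('a \<Rightarrow> 'v) \<Rightarrow> 'a vfield list \<Rightarrow> 'a \<Rightarrow> real"
  assumes pseudoconnection: "pseudoconnection M \<xi> (DD0 M k) nabla P"
begin

abbreviation "\<X> \<equiv> carrier (vfields M)"
abbreviation "\<Omega> \<equiv> carrier (sections M \<xi>)"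
abbreviation "T \<equiv> vf_tuples M k"
abbreviation "R \<equiv> curvature M k nabla"

lemma DD0_abelian_group: "abelian_group (DD0 M k)"
  using pseudoconnection Module.module.axioms(2) unfolding pseudoconnection_def by blast

lemma nabla_left: "s \<in> \<Omega> \<Longrightarrow> real_linear M (vfields M) (DD0 M k) (\<lambda>X. nabla X s)"
  and nabla_right: "X \<in> \<X> \<Longrightarrow> real_linear M (sections M \<xi>) (DD0 M k) (nabla X)"
  and P_hom: "P \<in> module_hom (smooth_ring M) (sections M \<xi>) (DD0 M k)"
  using pseudoconnection unfolding pseudoconnection_def real_bilinear_def by auto

lemma nabla_in_DD0: "X \<in> \<X> \<Longrightarrow> s \<in> \<Omega> \<Longrightarrow> nabla X s \<in> carrier (DD0 M k)"
  using nabla_left unfolding real_linear_def by blast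

lemma nabla_closed: "X \<in> \<X> \<Longrightarrow> s \<in> \<Omega> \<Longrightarrow> nabla X s \<in> carrier (DD M k)"
  by (intro DD0_subset nabla_in_DD0)

lemma P_closed: "s \<in> \<Omega> \<Longrightarrow> P s \<in> carrier (DD M k)"
  using P_hom DD0_subset unfolding module_hom_def by blast

lemma P_add: "s \<in> \<Omega> \<Longrightarrow> t \<in> \<Omega> \<Longrightarrow> P (s \<oplus>\<^bsub>sections M \<xi>\<^esub> t) = P s \<oplus>\<^bsub>DD M k\<^esub> P t"
  using P_hom unfolding module_hom_def DD0_simps by blast

lemma nabla_add_left: "X \<in> \<X> \<Longrightarrow> Y \<in> \<X> \<Longrightarrow> s \<in> \<Omega> \<Longrightarrow>
    nabla (X \<oplus>\<^bsub>vfields M\<^esub> Y) s = nabla X s \<oplus>\<^bsub>DD M k\<^esub> nabla Y s"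
  using nabla_left unfolding real_linear_def DD0_simps by blast

lemma nabla_add_right: "X \<in> \<X> \<Longrightarrow> s \<in> \<Omega> \<Longrightarrow> t \<in> \<Omega> \<Longrightarrow>
    nabla X (s \<oplus>\<^bsub>sections M \<xi>\<^esub> t) = nabla X s \<oplus>\<^bsub>DD M k\<^esub> nabla X t"
  using nabla_right unfolding real_linear_def DD0_simps by blast

lemma nabla_const_right: "X \<in> \<X> \<Longrightarrow> s \<in> \<Omega> \<Longrightarrow>
    nabla X (const_fun M c \<odot>\<^bsub>sections M \<xi>\<^esub> s) = const_fun M c \<odot>\<^bsub>DD M k\<^esub> nabla X s"
  using nabla_right unfolding real_linear_def DD0_simps by blast

lemma nabla_smult_left: "X \<in> \<X> \<Longrightarrow> s \<in> \<Omega> \<Longrightarrow> f \<in> carrier (smooth_ring M) \<Longrightarrow>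
    nabla (f \<odot>\<^bsub>vfields M\<^esub> X) s = f \<odot>\<^bsub>DD M k\<^esub> nabla X s"
  and nabla_smult_right: "X \<in> \<X> \<Longrightarrow> s \<in> \<Omega> \<Longrightarrow> f \<in> carrier (smooth_ring M) \<Longrightarrow>
    nabla X (f \<odot>\<^bsub>sections M \<xi>\<^esub> s) = (vf_app M X f \<odot>\<^bsub>DD M k\<^esub> P s) \<oplus>\<^bsub>DD M k\<^esub> (f \<odot>\<^bsub>DD M k\<^esub> nabla X s)"
  using pseudoconnection unfolding pseudoconnection_def DD0_simps by blast+

lemma nabla_minus_left_app:
  assumes X: "X \<in> \<X>" and Y: "Y \<in> \<X>" and s: "s \<in> \<Omega>" and q: "Xs \<in> T" "p \<in> pts M"
  shows "nabla (X \<ominus>\<^bsub>vfields M\<^esub> Y) s Xs p = nabla X s Xs p - nabla Y s Xs p"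
  by (simp add: vfields_minus_eq[OF X Y] nabla_add_left[OF X vfields_smult_closed[OF const_fun_closed Y] s]
      nabla_smult_left[OF Y s const_fun_closed] DD_add_app DD_smult_app const_fun_app q)

text \<open>The hypotheses concern the values of \<open>nabla\<close> and not \<open>s\<close>
  itself. Thus the formulas also apply to sums and multiples of sections, where the rules of a
  pseudoconnection place these values in \<open>DD M k\<close> directly.\<close>

lemma
  assumes "X \<in> \<X>" "Y \<in> \<X>" "nabla X s \<in> carrier (DD M k)" "nabla Y s \<in> carrier (DD M k)"
    "nabla (bracket M X Y) s \<in> carrier (DD M k)"
  shows curvature_closed': "R X Y s \<in> carrier (DD M k)"
    and curvature_app': "Xs \<in> T \<Longrightarrow> p \<in> pts M \<Longrightarrow>
      R X Y s Xs p = X p (nabla Y s Xs) - Y p (nabla X s Xs) - nabla (bracket M X Y) s Xs p"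
  unfolding curvature_def using assms
  by (simp_all add: DD_minus_closed vf_appD_closed DD_minus_app vf_appD_app)

lemma curvature_closed: "X \<in> \<X> \<Longrightarrow> Y \<in> \<X> \<Longrightarrow> s \<in> \<Omega> \<Longrightarrow> R X Y s \<in> carrier (DD M k)"
  and curvature_app: "X \<in> \<X> \<Longrightarrow> Y \<in> \<X> \<Longrightarrow> s \<in> \<Omega> \<Longrightarrow> Xs \<in> T \<Longrightarrow> p \<in> pts M \<Longrightarrow>
    R X Y s Xs p = X p (nabla Y s Xs) - Y p (nabla X s Xs) - nabla (bracket M X Y) s Xs p"
  by (simp_all add: curvature_closed' curvature_app' nabla_closed bracket_closed)

lemma del_nabla_closed: "X \<in> \<X> \<Longrightarrow> s \<in> \<Omega> \<Longrightarrow> del_nabla M k nabla P X s \<in> carrier (DD M k)"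
  and del_nabla_app: "X \<in> \<X> \<Longrightarrow> s \<in> \<Omega> \<Longrightarrow> Xs \<in> T \<Longrightarrow> p \<in> pts M \<Longrightarrow>
    del_nabla M k nabla P X s Xs p = X p (P s Xs) - nabla X s Xs p"
  by (simp_all add: del_nabla_def DD_minus_closed DD_minus_app vf_appD_closed vf_appD_app nabla_closed P_closed)

lemma nabla_near: "X \<in> \<X> \<Longrightarrow> s \<in> \<Omega> \<Longrightarrow> Xs \<in> T \<Longrightarrow> p \<in> pts M \<Longrightarrow> nabla X s Xs \<in> smooth_near M p"
  and P_near: "s \<in> \<Omega> \<Longrightarrow> Xs \<in> T \<Longrightarrow> p \<in> pts M \<Longrightarrow> P s Xs \<in> smooth_near M p"
  by (auto intro: DD_near[OF nabla_closed] DD_near[OF P_closed])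

section \<open>Identities for the curvature\<close>

lemma curvature_antisym:
  assumes X: "X \<in> \<X>" and Y: "Y \<in> \<X>" and s: "s \<in> \<Omega>"
  shows "R X Y s = \<ominus>\<^bsub>DD M k\<^esub> R Y X s"
proof (rule DD_eqI[OF curvature_closed[OF X Y s] DD_uminus_closed[OF curvature_closed[OF Y X s]]])
  fix Xs p assume q: "Xs \<in> T" "p \<in> pts M"
  have "nabla (bracket M X Y) s Xs p = - nabla (bracket M Y X) s Xs p"
    by (simp add: bracket_antisym[OF X Y] nabla_smult_left[OF bracket_closed[OF Y X] s const_fun_closed]
        DD_smult_app const_fun_app q)
  then show "R X Y s Xs p = (\<ominus>\<^bsub>DD M k\<^esub> R Y X s) Xs p"
    by (simp add: DD_uminus_app curvature_closed curvature_app X Y s q)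
qed

text \<open>The term \<open>Y(f) nabla X s\<close> arises twice, from differentiating
  \<open>f nabla X s\<close> by \<open>Y\<close> and from the bracket of \<open>f X\<close> with
  \<open>Y\<close>, and the two contributions cancel.\<close>

lemma curvature_smult_left:
  assumes X: "X \<in> \<X>" and Y: "Y \<in> \<X>" and s: "s \<in> \<Omega>" and f: "f \<in> carrier (smooth_ring M)"
  shows "R (f \<odot>\<^bsub>vfields M\<^esub> X) Y s = f \<odot>\<^bsub>DD M k\<^esub> R X Y s"
proof (rule DD_eqI)
  note fX = vfields_smult_closed[OF f X] and YfX = vfields_smult_closed[OF vf_app_closed[OF Y f] X]
    and XY = bracket_closed[OF X Y]
  show "R (f \<odot>\<^bsub>vfields M\<^esub> X) Y s \<in> carrier (DD M k)" by (rule curvature_closed[OF fX Y s])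
  show "f \<odot>\<^bsub>DD M k\<^esub> R X Y s \<in> carrier (DD M k)" by (rule DD_smult_closed[OF f curvature_closed[OF X Y s]])
  fix Xs p assume q: "Xs \<in> T" "p \<in> pts M"
  have "Y p (nabla (f \<odot>\<^bsub>vfields M\<^esub> X) s Xs) = f p * Y p (nabla X s Xs) + nabla X s Xs p * Y p f"
    by (rule vfield_prod[OF Y q(2) smooth_ring_near[OF f q(2)] nabla_near[OF X s q]])
      (simp add: nabla_smult_left[OF X s f] DD_smult_app q)
  moreover have "nabla (bracket M (f \<odot>\<^bsub>vfields M\<^esub> X) Y) s Xs p =
      f p * nabla (bracket M X Y) s Xs p - Y p f * nabla X s Xs p"
    by (simp add: bracket_smult_left[OF X Y f] nabla_minus_left_app[OF vfields_smult_closed[OF f XY] YfX s q]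
        nabla_smult_left[OF XY s f] nabla_smult_left[OF X s vf_app_closed[OF Y f]] DD_smult_app q vf_app_app)
  ultimately show "R (f \<odot>\<^bsub>vfields M\<^esub> X) Y s Xs p = (f \<odot>\<^bsub>DD M k\<^esub> R X Y s) Xs p"
    by (simp add: curvature_app fX X Y s q DD_smult_app vfields_smult_app nabla_near algebra_simps)
qed

lemma curvature_add_left:
  assumes X: "X \<in> \<X>" and X': "X' \<in> \<X>" and Y: "Y \<in> \<X>" and s: "s \<in> \<Omega>"
  shows "R (X \<oplus>\<^bsub>vfields M\<^esub> X') Y s = R X Y s \<oplus>\<^bsub>DD M k\<^esub> R X' Y s"
proof (rule DD_eqI)
  note XX' = vfields_add_closed[OF X X']
  show "R (X \<oplus>\<^bsub>vfields M\<^esub> X') Y s \<in> carrier (DD M k)" by (rule curvature_closed[OF XX' Y s])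
  show "R X Y s \<oplus>\<^bsub>DD M k\<^esub> R X' Y s \<in> carrier (DD M k)"
    by (intro DD_add_closed curvature_closed X X' Y s)
  fix Xs p assume q: "Xs \<in> T" "p \<in> pts M"
  have "Y p (nabla (X \<oplus>\<^bsub>vfields M\<^esub> X') s Xs) = Y p (nabla X s Xs) + Y p (nabla X' s Xs)"
    by (rule vfield_sum[OF Y q(2) nabla_near[OF X s q] nabla_near[OF X' s q]])
      (simp add: nabla_add_left[OF X X' s] DD_add_app q)
  then show "R (X \<oplus>\<^bsub>vfields M\<^esub> X') Y s Xs p = (R X Y s \<oplus>\<^bsub>DD M k\<^esub> R X' Y s) Xs p"
    by (simp add: curvature_app XX' X X' Y s q DD_add_app vfields_add_app nabla_near
        bracket_add_left[OF X X' Y] nabla_add_left bracket_closed)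
qed

lemma curvature_add_section:
  assumes X: "X \<in> \<X>" and Y: "Y \<in> \<X>" and s: "s \<in> \<Omega>" and t: "t \<in> \<Omega>"
  shows "R X Y (s \<oplus>\<^bsub>sections M \<xi>\<^esub> t) = R X Y s \<oplus>\<^bsub>DD M k\<^esub> R X Y t"
proof (rule DD_eqI)
  have cl: "nabla Z (s \<oplus>\<^bsub>sections M \<xi>\<^esub> t) \<in> carrier (DD M k)" if "Z \<in> \<X>" for Z
    by (simp add: nabla_add_right that s t DD_add_closed nabla_closed)
  note st = X Y cl[OF X] cl[OF Y] cl[OF bracket_closed[OF X Y]]
  show "R X Y (s \<oplus>\<^bsub>sections M \<xi>\<^esub> t) \<in> carrier (DD M k)" by (rule curvature_closed'[OF st])
  show "R X Y s \<oplus>\<^bsub>DD M k\<^esub> R X Y t \<in> carrier (DD M k)"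
    by (intro DD_add_closed curvature_closed X Y s t)
  fix Xs p assume q: "Xs \<in> T" "p \<in> pts M"
  have D: "Z p (nabla W (s \<oplus>\<^bsub>sections M \<xi>\<^esub> t) Xs) = Z p (nabla W s Xs) + Z p (nabla W t Xs)"
    if "Z \<in> \<X>" "W \<in> \<X>" for Z W
    by (rule vfield_sum[OF that(1) q(2) nabla_near[OF that(2) s q] nabla_near[OF that(2) t q]])
      (simp add: nabla_add_right[OF that(2) s t] DD_add_app q)
  show "R X Y (s \<oplus>\<^bsub>sections M \<xi>\<^esub> t) Xs p = (R X Y s \<oplus>\<^bsub>DD M k\<^esub> R X Y t) Xs p"
    by (simp add: curvature_app'[OF st] D[OF X Y] D[OF Y X] curvature_app X Y s t q DD_add_app
        nabla_add_right[OF bracket_closed[OF X Y] s t])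
qed

text \<open>The second derivatives of \<open>f\<close> form \<open>(X(Y f) - Y(X f)) P(s)\<close>,
  which the bracket term removes. The first derivatives of \<open>f\<close> collect to
  \<open>Y(f) (X(P s) - nabla X s) - X(f) (Y(P s) - nabla Y s)\<close>. This is
  \<open>del_nabla\<close> at \<open>df2 M f X Y\<close>, both of its summands being linear over
  smooth functions in the vector field.\<close>

lemma curvature_smult_section:
  assumes X: "X \<in> \<X>" and Y: "Y \<in> \<X>" and s: "s \<in> \<Omega>" and f: "f \<in> carrier (smooth_ring M)"
  shows "R X Y (f \<odot>\<^bsub>sections M \<xi>\<^esub> s) =
    del_nabla M k nabla P (df2 M f X Y) s \<oplus>\<^bsub>DD M k\<^esub> (f \<odot>\<^bsub>DD M k\<^esub> R X Y s)"
proof (rule DD_eqI)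
  have cl: "nabla Z (f \<odot>\<^bsub>sections M \<xi>\<^esub> s) \<in> carrier (DD M k)" if "Z \<in> \<X>" for Z
    by (simp add: nabla_smult_right that s f DD_add_closed DD_smult_closed nabla_closed P_closed vf_app_closed)
  note XY = bracket_closed[OF X Y]
  note fs = X Y cl[OF X] cl[OF Y] cl[OF XY]
  note YfX = vfields_smult_closed[OF vf_app_closed[OF Y f] X] and XfY = vfields_smult_closed[OF vf_app_closed[OF X f] Y]
  have df: "df2 M f X Y \<in> \<X>" unfolding df2_def by (rule vfields_minus_closed[OF YfX XfY])
  show "R X Y (f \<odot>\<^bsub>sections M \<xi>\<^esub> s) \<in> carrier (DD M k)" by (rule curvature_closed'[OF fs])
  show "del_nabla M k nabla P (df2 M f X Y) s \<oplus>\<^bsub>DD M k\<^esub> (f \<odot>\<^bsub>DD M k\<^esub> R X Y s) \<in> carrier (DD M k)"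
    by (intro DD_add_closed DD_smult_closed del_nabla_closed curvature_closed X Y s f df)
  fix Xs p assume q: "Xs \<in> T" "p \<in> pts M"
  note nf = smooth_ring_near[OF f q(2)]
  have D: "Z p (nabla W (f \<odot>\<^bsub>sections M \<xi>\<^esub> s) Xs) =
      W p f * Z p (P s Xs) + P s Xs p * Z p (\<lambda>q. W q f) + f p * Z p (nabla W s Xs) + nabla W s Xs p * Z p f"
    if "Z \<in> \<X>" "W \<in> \<X>" for Z W
    by (rule vfield_leibniz[OF that(1) q(2) smooth_near_vfield[OF that(2) nf] P_near[OF s q] nf
          nabla_near[OF that(2) s q]])
      (simp add: nabla_smult_right[OF that(2) s f] DD_add_app DD_smult_app vf_app_app q)
  have B: "nabla (bracket M X Y) (f \<odot>\<^bsub>sections M \<xi>\<^esub> s) Xs p =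
      (X p (\<lambda>q. Y q f) - Y p (\<lambda>q. X q f)) * P s Xs p + f p * nabla (bracket M X Y) s Xs p"
    by (simp add: nabla_smult_right[OF XY s f] DD_add_app DD_smult_app vf_app_app q bracket_app nf)
  have del: "del_nabla M k nabla P (df2 M f X Y) s Xs p =
      Y p f * (X p (P s Xs) - nabla X s Xs p) - X p f * (Y p (P s Xs) - nabla Y s Xs p)"
    unfolding del_nabla_app[OF df s q] unfolding df2_def
    by (simp add: vfields_minus_app[OF YfX XfY q(2) P_near[OF s q]] vfields_smult_app q P_near s
        nabla_minus_left_app[OF YfX XfY s q] nabla_smult_left X Y vf_app_closed f DD_smult_app vf_app_app
        algebra_simps)
  show "R X Y (f \<odot>\<^bsub>sections M \<xi>\<^esub> s) Xs p =
      (del_nabla M k nabla P (df2 M f X Y) s \<oplus>\<^bsub>DD M k\<^esub> (f \<odot>\<^bsub>DD M k\<^esub> R X Y s)) Xs p"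
    by (simp add: curvature_app'[OF fs q] D[OF X Y] D[OF Y X] B DD_add_app q DD_smult_app del
        curvature_app[OF X Y s q] algebra_simps)
qed

text \<open>Real homogeneity of \<open>nabla\<close> and the vanishing of derivatives of constants
  give this directly, without the detour through \<open>del_nabla\<close> at the field
  \<open>df2\<close> of a constant.\<close>

lemma curvature_const_section:
  assumes X: "X \<in> \<X>" and Y: "Y \<in> \<X>" and s: "s \<in> \<Omega>"
  shows "R X Y (const_fun M c \<odot>\<^bsub>sections M \<xi>\<^esub> s) = const_fun M c \<odot>\<^bsub>DD M k\<^esub> R X Y s"
proof (rule DD_eqI)
  have cl: "nabla Z (const_fun M c \<odot>\<^bsub>sections M \<xi>\<^esub> s) \<in> carrier (DD M k)" if "Z \<in> \<X>" for Z
    by (simp add: nabla_const_right that s DD_smult_closed nabla_closed const_fun_closed)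
  note XY = bracket_closed[OF X Y]
  note cs = X Y cl[OF X] cl[OF Y] cl[OF XY]
  show "R X Y (const_fun M c \<odot>\<^bsub>sections M \<xi>\<^esub> s) \<in> carrier (DD M k)" by (rule curvature_closed'[OF cs])
  show "const_fun M c \<odot>\<^bsub>DD M k\<^esub> R X Y s \<in> carrier (DD M k)"
    by (intro DD_smult_closed const_fun_closed curvature_closed X Y s)
  fix Xs p assume q: "Xs \<in> T" "p \<in> pts M"
  have D: "Z p (nabla W (const_fun M c \<odot>\<^bsub>sections M \<xi>\<^esub> s) Xs) = c * Z p (nabla W s Xs)"
    if "Z \<in> \<X>" "W \<in> \<X>" for Z W
    using vfield_prod[OF that(1) q(2) smooth_near_const[OF q(2)] nabla_near[OF that(2) s q],
        of "nabla W (const_fun M c \<odot>\<^bsub>sections M \<xi>\<^esub> s) Xs" c]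
    by (simp add: nabla_const_right[OF that(2) s] DD_smult_app q const_fun_app
        tangent_vectors_const[OF vfield_tangent[OF that(1) q(2)] q(2)])
  show "R X Y (const_fun M c \<odot>\<^bsub>sections M \<xi>\<^esub> s) Xs p = (const_fun M c \<odot>\<^bsub>DD M k\<^esub> R X Y s) Xs p"
    by (simp add: curvature_app'[OF cs q] curvature_app[OF X Y s q] D[OF X Y] D[OF Y X] DD_smult_app q
        nabla_const_right[OF XY s] const_fun_app algebra_simps)
qed

lemma curvature_trilinear:
  "real_trilinear M (vfields M) (vfields M) (sections M \<xi>) (DD M k) R"
  unfolding real_trilinear_def
proof (intro conjI ballI)
  have 1: "real_linear M (vfields M) (DD M k) (\<lambda>X. R X Y s)" if "Y \<in> \<X>" "s \<in> \<Omega>" for Y s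
    unfolding real_linear_def using that
    by (auto simp: curvature_closed curvature_add_left curvature_smult_left const_fun_closed)
  then show "real_linear M (vfields M) (DD M k) (\<lambda>X. R X Y s)" if "Y \<in> \<X>" "s \<in> \<Omega>" for Y s
    using that .
  \<comment> \<open>Antisymmetry carries linearity over from the first argument to the
    second.\<close>
  show "real_linear M (vfields M) (DD M k) (\<lambda>Y. R X Y s)" if X: "X \<in> \<X>" and s: "s \<in> \<Omega>" for X s
    unfolding real_linear_def
  proof (intro conjI ballI allI)
    show "(\<lambda>Y. R X Y s) \<in> \<X> \<rightarrow> carrier (DD M k)" using X s by (auto simp: curvature_closed)
    fix Y assume Y: "Y \<in> \<X>"
    show "R X (Y \<oplus>\<^bsub>vfields M\<^esub> Y') s = R X Y s \<oplus>\<^bsub>DD M k\<^esub> R X Y' s" if Y': "Y' \<in> \<X>" for Y'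
      by (rule DD_eqI[where k = k]) (simp_all add: curvature_antisym[OF X] X Y Y' s vfields_add_closed DD_add_closed
          DD_uminus_closed curvature_closed curvature_add_left DD_add_app DD_uminus_app)
    show "R X (const_fun M c \<odot>\<^bsub>vfields M\<^esub> Y) s = const_fun M c \<odot>\<^bsub>DD M k\<^esub> R X Y s" for c
      by (rule DD_eqI[where k = k]) (simp_all add: curvature_antisym[OF X] X Y s vfields_smult_closed const_fun_closed
          DD_uminus_closed curvature_closed curvature_smult_left DD_smult_closed DD_smult_app DD_uminus_app)
  qed
  show "real_linear M (sections M \<xi>) (DD M k) (R X Y)" if "X \<in> \<X>" "Y \<in> \<X>" for X Y
    unfolding real_linear_def using that
    by (auto simp: curvature_closed curvature_add_section curvature_const_section)
qed

end

section \<open>The cyclic identity for torsion-free pseudoconnections\<close>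

lemma (in smooth_mfd) bianchi:
  assumes pc: "pseudoconnection M (tangent_bundle M) (DD0 M k) nabla P"
    and tf: "torsion_free M (DD0 M k) nabla P"
    and X: "X \<in> carrier (vfields M)" and Y: "Y \<in> carrier (vfields M)" and Z: "Z \<in> carrier (vfields M)"
  shows "curvature M k nabla X Y Z \<oplus>\<^bsub>DD M k\<^esub> curvature M k nabla Y Z X
      \<oplus>\<^bsub>DD M k\<^esub> curvature M k nabla Z X Y =
    del_nabla M k nabla P X (bracket M Y Z) \<oplus>\<^bsub>DD M k\<^esub> del_nabla M k nabla P Y (bracket M Z X)
      \<oplus>\<^bsub>DD M k\<^esub> del_nabla M k nabla P Z (bracket M X Y)"
proof -
  \<comment> \<open>With the tangent bundle in place of the general bundle, sections are vector
    fields and may stand in any of the three arguments of the curvature.\<close>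
  interpret pseudoconn M "tangent_bundle M" k nabla P by unfold_locales (rule pc)
  have torsion: "P (bracket M A B) Xs p = nabla A B Xs p - nabla B A Xs p"
    if "A \<in> \<X>" "B \<in> \<X>" "Xs \<in> T" "p \<in> pts M" for A B Xs p
  proof -
    have "P (bracket M A B) = nabla A B \<ominus>\<^bsub>DD0 M k\<^esub> nabla B A"
      using tf that(1,2) by (simp add: torsion_free_def)
    then show ?thesis using DD0_minus_app[OF DD0_abelian_group nabla_in_DD0[OF that(2,1)] that(3,4)] by simp
  qed
  note br = bracket_closed[OF X Y] bracket_closed[OF Y Z] bracket_closed[OF Z X]
  note brbr = bracket_closed[OF X br(2)] bracket_closed[OF Y br(3)] bracket_closed[OF Z br(1)]
  show ?thesis
  proof (rule DD_eqI)
    fix Xs p assume q: "Xs \<in> T" "p \<in> pts M"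
    \<comment> \<open>Torsion freeness holds at all points, so it may be differentiated:
      \<open>X(P [Y,Z])\<close> splits into two of the six derivative terms of the cyclic curvature
      sum.\<close>
    have D: "C p (P (bracket M A B) Xs) = C p (nabla A B Xs) - C p (nabla B A Xs)"
      if "A \<in> \<X>" "B \<in> \<X>" "C \<in> \<X>" for A B C
      by (rule vfield_difference[OF that(3) q(2) nabla_near[OF that(1,2) q] nabla_near[OF that(2,1) q]])
        (rule torsion[OF that(1,2) q(1)])
    \<comment> \<open>Additivity alone yields this: \<open>P 0 = P 0 + P 0\<close>, evaluated at a
      point.\<close>
    have "P \<zero>\<^bsub>vfields M\<^esub> Xs p = 0"
    proof -
      have "\<zero>\<^bsub>vfields M\<^esub> \<oplus>\<^bsub>vfields M\<^esub> \<zero>\<^bsub>vfields M\<^esub> = \<zero>\<^bsub>vfields M\<^esub>"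
        by (rule abelian_monoid.l_zero[OF abelian_group.axioms(1)[OF vfields_abelian_group] vfields_zero_closed])
      then have "P \<zero>\<^bsub>vfields M\<^esub> = P \<zero>\<^bsub>vfields M\<^esub> \<oplus>\<^bsub>DD M k\<^esub> P \<zero>\<^bsub>vfields M\<^esub>"
        using P_add[OF vfields_zero_closed vfields_zero_closed] by simp
      then show ?thesis using DD_add_app[OF q, of "P \<zero>\<^bsub>vfields M\<^esub>" "P \<zero>\<^bsub>vfields M\<^esub>"] by simp
    qed
    then have "P (bracket M X (bracket M Y Z)) Xs p + P (bracket M Y (bracket M Z X)) Xs p
        + P (bracket M Z (bracket M X Y)) Xs p = 0"
      \<comment> \<open>The Jacobi identity is used from right to left: the zero field inside
        \<open>P\<close> is replaced by the sum of double brackets, over which \<open>P\<close>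
        distributes.\<close>
      by (simp flip: jacobi[OF X Y Z]
          add: P_add[OF vfields_add_closed[OF brbr(1,2)] brbr(3)] P_add[OF brbr(1,2)] DD_add_app[OF q])
    \<comment> \<open>After \<open>D\<close> the derivative terms agree. What remains is that the
      cyclic sum of \<open>nabla X [Y,Z] - nabla [Y,Z] X\<close> is zero, and this is the vanishing
      sum of \<open>P\<close>-values rewritten by \<open>torsion\<close>.\<close>
    then show "(R X Y Z \<oplus>\<^bsub>DD M k\<^esub> R Y Z X \<oplus>\<^bsub>DD M k\<^esub> R Z X Y) Xs p =
      (del_nabla M k nabla P X (bracket M Y Z) \<oplus>\<^bsub>DD M k\<^esub> del_nabla M k nabla P Y (bracket M Z X)
        \<oplus>\<^bsub>DD M k\<^esub> del_nabla M k nabla P Z (bracket M X Y)) Xs p"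
      by (simp add: DD_add_app q curvature_app del_nabla_app X Y Z br D torsion)
  qed (simp_all add: DD_add_closed curvature_closed del_nabla_closed X Y Z br)
qed

text \<open>Fibres of the tangent bundle consist of derivations, whereas the fibre type
  \<open>'v\<close> is arbitrary. The case of the tangent bundle is therefore expressed by
  pseudoconnections \<open>nablaT\<close> of \<open>tangent_bundle M\<close> with their own
  principal homomorphism \<open>PT\<close>.\<close>

theorem theorem3p6:
  fixes M :: "'a mfd" and \<xi> :: "('a, 'v) vbundle" and k :: nat
    and nabla :: "'a vfield \<Rightarrow> ('a \<Rightarrow> 'v) \<Rightarrow> 'a vfield list \<Rightarrow> 'a \<Rightarrow> real"
    and P :: "('a \<Rightarrow> 'v) \<Rightarrow> 'a vfield list \<Rightarrow> 'a \<Rightarrow> real"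
  assumes "smooth_manifold M" and "vector_bundle M \<xi>" and "k \<ge> 1"
    and "pseudoconnection M \<xi> (DD0 M k) nabla P"
  shows
    "real_trilinear M (vfields M) (vfields M) (sections M \<xi>) (DD M k) (curvature M k nabla) \<and>
     (\<forall>X\<in>carrier (vfields M). \<forall>Y\<in>carrier (vfields M). \<forall>s\<in>carrier (sections M \<xi>).
        curvature M k nabla X Y s = \<ominus>\<^bsub>DD M k\<^esub> curvature M k nabla Y X s) \<and>
     (\<forall>X\<in>carrier (vfields M). \<forall>Y\<in>carrier (vfields M). \<forall>s\<in>carrier (sections M \<xi>).
      \<forall>f\<in>carrier (smooth_ring M).
        curvature M k nabla (f \<odot>\<^bsub>vfields M\<^esub> X) Y s = f \<odot>\<^bsub>DD M k\<^esub> curvature M k nabla X Y s) \<and>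
     (\<forall>X\<in>carrier (vfields M). \<forall>Y\<in>carrier (vfields M). \<forall>s\<in>carrier (sections M \<xi>).
      \<forall>f\<in>carrier (smooth_ring M).
        curvature M k nabla X Y (f \<odot>\<^bsub>sections M \<xi>\<^esub> s) =
          del_nabla M k nabla P (df2 M f X Y) s \<oplus>\<^bsub>DD M k\<^esub>
          (f \<odot>\<^bsub>DD M k\<^esub> curvature M k nabla X Y s)) \<and>
     (\<forall>nablaT PT.
        pseudoconnection M (tangent_bundle M) (DD0 M k) nablaT PT \<and>
        torsion_free M (DD0 M k) nablaT PT \<longrightarrow>
        (\<forall>X\<in>carrier (vfields M). \<forall>Y\<in>carrier (vfields M). \<forall>Z\<in>carrier (vfields M).
           curvature M k nablaT X Y Z \<oplus>\<^bsub>DD M k\<^esub> curvature M k nablaT Y Z X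
             \<oplus>\<^bsub>DD M k\<^esub> curvature M k nablaT Z X Y =
           del_nabla M k nablaT PT X (bracket M Y Z)
             \<oplus>\<^bsub>DD M k\<^esub> del_nabla M k nablaT PT Y (bracket M Z X)
             \<oplus>\<^bsub>DD M k\<^esub> del_nabla M k nablaT PT Z (bracket M X Y)))"
proof -
  interpret pseudoconn M \<xi> k nabla P
    using assms(1,4) by (simp add: pseudoconn_def smooth_mfd_def pseudoconn_axioms_def)
  show ?thesis
  proof (intro conjI)
    show "real_trilinear M (vfields M) (vfields M) (sections M \<xi>) (DD M k) R"
      by (rule curvature_trilinear)
  next
    show "\<forall>X\<in>\<X>. \<forall>Y\<in>\<X>. \<forall>s\<in>\<Omega>. R X Y s = \<ominus>\<^bsub>DD M k\<^esub> R Y X s"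
      by (intro ballI) (rule curvature_antisym)
  next
    show "\<forall>X\<in>\<X>. \<forall>Y\<in>\<X>. \<forall>s\<in>\<Omega>. \<forall>f\<in>carrier (smooth_ring M).
        R (f \<odot>\<^bsub>vfields M\<^esub> X) Y s = f \<odot>\<^bsub>DD M k\<^esub> R X Y s"
      by (intro ballI) (rule curvature_smult_left)
  next
    show "\<forall>X\<in>\<X>. \<forall>Y\<in>\<X>. \<forall>s\<in>\<Omega>. \<forall>f\<in>carrier (smooth_ring M).
        R X Y (f \<odot>\<^bsub>sections M \<xi>\<^esub> s) =
          del_nabla M k nabla P (df2 M f X Y) s \<oplus>\<^bsub>DD M k\<^esub> (f \<odot>\<^bsub>DD M k\<^esub> R X Y s)"
      by (intro ballI) (rule curvature_smult_section)
  qed (intro allI impI ballI, elim conjE, rule bianchi)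
qed

end
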